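(* Let $\ell:\mathbb{R}^{n\times m}\to\mathbb{R}$ be twice differentiable, $K$-smooth and $\mu$-strongly convex with $\min_W\ell(W)=0$, and let $\frac14<p<\frac12$. Let $W_1(0)\in\mathbb{R}^{n\times h}$ and $W_2(0)\in\mathbb{R}^{m\times h}$ have i.i.d. entries drawn from $\mathcal{N}(0,h^{-2p})$. Then for all $\delta\in(0,1)$ and all $h\ge\mathrm{poly}(m,n,\frac1\delta)$ (i.e. $h$ larger than a suitable polynomial in $m,n,1/\delta$), with probability at least $1-\delta$ over the random initialization $W_1(0),W_2(0)$, $$\frac{\sigma_{\min}(\mathcal{T}_0)}{\sigma_{\max}(\mathcal{T}_0)}\ \ge\ \frac{\alpha_1}{\alpha_2}\ \ge\ 1-C\,h^{2p-1},$$ where $C>0$ is a constant that does not depend on $h$.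
   Context: $K$-smooth means $\ell(V)\le \ell(W)+\langle\nabla\ell(W),V-W\rangle+\frac K2\|V-W\|_F^2$ for all $V,W$. Let $W^*$ be the minimizer of $\ell$ and $W(0)=W_1(0)W_2(0)^\top$. $\mathcal{T}_0:\mathbb{R}^{n\times m}\to\mathbb{R}^{(n+m)\times h}$ is the linear operator $U\mapsto \begin{bmatrix}UW_2(0)\\ U^\top W_1(0)\end{bmatrix}$; $\sigma_{\max}^2(\mathcal{T}_0),\sigma_{\min}^2(\mathcal{T}_0)$ are the largest and smallest eigenvalues of $\mathcal{T}_0^*\circ\mathcal{T}_0$. $\sigma_{\max}(A),\sigma_{\min}(A)$ denote the largest and smallest singular values of a matrix $A$, and $\lambda_i(A)$ the $i$-th largest eigenvalue of a symmetric matrix $A$. Let $D(0)=W_1(0)^\top W_1(0)-W_2(0)^\top W_2(0)\in\mathbb{R}^{h\times h}$ and $$\lambda_-=\max(\lambda_{\max}(-D(0)),0),\qquad \lambda_+=\max(\lambda_{\max}(D(0)),0),$$ $$\underline{\Delta}=\max(\lambda_n(D(0)),0)+\max(\lambda_m(-D(0)),0),$$ $$\Delta_+=\lambda_+-\max(\lambda_n(D(0)),0),\qquad \Delta_-=\lambda_--\max(\lambda_m(-D(0)),0),$$ $$\beta_1=\max\Bigl(0,\ \sigma_{\min}(W^* )-\sqrt{\tfrac K\mu}\,\|W(0)-W^*\|_F\Bigr),\qquad \beta_2=\sigma_{\max}(W^* )+\sqrt{\tfrac K\mu}\,\|W(0)-W^*\|_F,$$ $$\alpha_1=\frac{-\Delta_+-\Delta_-+\sqrt{(\Delta_++\underline{\Delta})^2+4\beta_1^2}+\sqrt{(\Delta_-+\underline{\Delta})^2+4\beta_1^2}}{2},$$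 $$\alpha_2=\frac{\lambda_++\sqrt{\lambda_+^2+4\beta_2^2}}{2}+\frac{\lambda_-+\sqrt{\lambda_-^2+4\beta_2^2}}{2}.$$ The quantities $n,m,p,\ell$ (hence $K,\mu,W^*$) are fixed as $h$ varies; the polynomial and the constant $C$ may depend on $p,\ell$, and $C$ may also depend on $n,m,\delta$. *)

theory Defs
  imports
    "HOL-Analysis.Analysis"
    "HOL-Probability.Probability"
    "Jordan_Normal_Form.Char_Poly"
begin

text \<open>
  The sizes \<open>n\<close> and \<open>m\<close> are the cardinalities of the index types \<open>'n\<close> and \<open>'m\<close>, and
  real \<open>n \<times> m\<close> matrices have type \<open>real ^ 'm ^ 'n\<close>, on which \<open>inner\<close> and \<open>norm\<close>
  are the Frobenius inner product and norm.  The width \<open>h\<close> varies inside the theorem and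
  is therefore a natural number: a matrix with \<open>h\<close> columns is a function
  \<open>row index \<Rightarrow> nat \<Rightarrow> real\<close> of which only the columns \<open>k < h\<close> are ever used.
\<close>

type_synonym 'r hmat = "'r \<Rightarrow> nat \<Rightarrow> real"


section \<open>The loss\<close>

definition gradient :: "('a::real_inner \<Rightarrow> real) \<Rightarrow> 'a \<Rightarrow> 'a" where
  "gradient f x = (THE g. GDERIV f x :> g)"

definition twice_differentiable :: "('a::real_inner \<Rightarrow> real) \<Rightarrow> bool" where
  "twice_differentiable f \<longleftrightarrow>
     (\<forall>x. f differentiable (at x)) \<and> (\<forall>x. gradient f differentiable (at x))"

definition K_smooth :: "real \<Rightarrow> ('a::real_inner \<Rightarrow> real) \<Rightarrow> bool" where
  "K_smooth K f \<longleftrightarrow>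
     (\<forall>V W. f V \<le> f W + inner (gradient f W) (V - W) + K / 2 * (norm (V - W))\<^sup>2)"

definition strongly_convex :: "real \<Rightarrow> ('a::real_inner \<Rightarrow> real) \<Rightarrow> bool" where
  "strongly_convex \<mu> f \<longleftrightarrow> \<mu> > 0 \<and>
     (\<forall>V W. f V \<ge> f W + inner (gradient f W) (V - W) + \<mu> / 2 * (norm (V - W))\<^sup>2)"


section \<open>Singular values and eigenvalues\<close>

text \<open>
  Singular values are the common values of pairs of singular vectors.  An \<open>n \<times> m\<close> matrix
  thus has \<open>min n m\<close> of them (with multiplicity): for instance, \<open>0\<close> is a singular value
  only if neither \<open>A\<close> nor its transpose has full column rank.
\<close>

definition singular_values :: "real ^ 'm::finite ^ 'n::finite \<Rightarrow> real set" where
  "singular_values A =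
     {s. s \<ge> 0 \<and> (\<exists>u v. norm u = 1 \<and> norm v = 1 \<and> A *v v = s *\<^sub>R u \<and> transpose A *v u = s *\<^sub>R v)}"

definition sigma_max :: "real ^ 'm::finite ^ 'n::finite \<Rightarrow> real" where
  "sigma_max A = Max (singular_values A)"

definition sigma_min :: "real ^ 'm::finite ^ 'n::finite \<Rightarrow> real" where
  "sigma_min A = Min (singular_values A)"

text \<open>
  \<open>eig i A\<close> is the \<open>i\<close>-th largest eigenvalue, counted with multiplicity and starting from
  \<open>i = 1\<close>, of a real symmetric matrix \<open>A\<close> of size at least \<open>i\<close>.
\<close>

definition eig :: "nat \<Rightarrow> real mat \<Rightarrow> real" where
  "eig i A = rev (sorted_list_of_multiset (proots (char_poly A))) ! (i - 1)"

abbreviation eig_max :: "real mat \<Rightarrow> real" where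
  "eig_max A \<equiv> eig 1 A"

definition operator_eigenvalues :: "('a::real_vector \<Rightarrow> 'a) \<Rightarrow> real set" where
  "operator_eigenvalues S = {c. \<exists>x. x \<noteq> 0 \<and> S x = c *\<^sub>R x}"


section \<open>The operator $\mathcal{T}_0$\<close>

text \<open>The rows of the stacked \<open>(n + m) \<times> h\<close> matrix are indexed by \<open>'n + 'm\<close>.\<close>

definition T_op ::
  "'n::finite hmat \<Rightarrow> 'm::finite hmat \<Rightarrow> real ^ 'm ^ 'n \<Rightarrow> ('n + 'm) hmat" where
  "T_op W1 W2 U = (\<lambda>r k. case r of
       Inl i \<Rightarrow> (\<Sum>j\<in>UNIV. U $ i $ j * W2 j k)
     | Inr j \<Rightarrow> (\<Sum>i\<in>UNIV. U $ i $ j * W1 i k))"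

definition frob_inner :: "nat \<Rightarrow> 'r::finite hmat \<Rightarrow> 'r hmat \<Rightarrow> real" where
  "frob_inner h A B = (\<Sum>r\<in>UNIV. \<Sum>k<h. A r k * B r k)"

text \<open>
  The library's \<open>adjoint\<close> needs inner product types on both sides; here the codomain carries
  the inner product \<open>frob_inner h\<close>.
\<close>

definition hadjoint :: "nat \<Rightarrow> ('a::real_inner \<Rightarrow> 'r::finite hmat) \<Rightarrow> 'r hmat \<Rightarrow> 'a" where
  "hadjoint h T = (SOME T'. \<forall>U V. inner U (T' V) = frob_inner h (T U) V)"

definition sigma_max_T :: "nat \<Rightarrow> 'n::finite hmat \<Rightarrow> 'm::finite hmat \<Rightarrow> real" where
  "sigma_max_T h W1 W2 =
     sqrt (Max (operator_eigenvalues (hadjoint h (T_op W1 W2) \<circ> T_op W1 W2)))"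

definition sigma_min_T :: "nat \<Rightarrow> 'n::finite hmat \<Rightarrow> 'm::finite hmat \<Rightarrow> real" where
  "sigma_min_T h W1 W2 =
     sqrt (Min (operator_eigenvalues (hadjoint h (T_op W1 W2) \<circ> T_op W1 W2)))"


section \<open>The quantities $\alpha_1$ and $\alpha_2$\<close>

definition W_prod :: "nat \<Rightarrow> 'n::finite hmat \<Rightarrow> 'm::finite hmat \<Rightarrow> real ^ 'm ^ 'n" where
  "W_prod h W1 W2 = (\<chi> i j. \<Sum>k<h. W1 i k * W2 j k)"

definition imbalance :: "nat \<Rightarrow> 'n::finite hmat \<Rightarrow> 'm::finite hmat \<Rightarrow> real mat" where
  "imbalance h W1 W2 =
     Matrix.mat h h (\<lambda>(k, l). (\<Sum>i\<in>UNIV. W1 i k * W1 i l) - (\<Sum>j\<in>UNIV. W2 j k * W2 j l))"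

definition lam_minus :: "nat \<Rightarrow> 'n::finite hmat \<Rightarrow> 'm::finite hmat \<Rightarrow> real" where
  "lam_minus h W1 W2 = max (eig_max (- imbalance h W1 W2)) 0"

definition lam_plus :: "nat \<Rightarrow> 'n::finite hmat \<Rightarrow> 'm::finite hmat \<Rightarrow> real" where
  "lam_plus h W1 W2 = max (eig_max (imbalance h W1 W2)) 0"

definition Delta_low :: "nat \<Rightarrow> 'n::finite hmat \<Rightarrow> 'm::finite hmat \<Rightarrow> real" where
  "Delta_low h (W1 :: 'n hmat) (W2 :: 'm hmat) =
     max (eig CARD('n) (imbalance h W1 W2)) 0 + max (eig CARD('m) (- imbalance h W1 W2)) 0"

definition Delta_plus :: "nat \<Rightarrow> 'n::finite hmat \<Rightarrow> 'm::finite hmat \<Rightarrow> real" where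
  "Delta_plus h (W1 :: 'n hmat) (W2 :: 'm hmat) =
     lam_plus h W1 W2 - max (eig CARD('n) (imbalance h W1 W2)) 0"

definition Delta_minus :: "nat \<Rightarrow> 'n::finite hmat \<Rightarrow> 'm::finite hmat \<Rightarrow> real" where
  "Delta_minus h (W1 :: 'n hmat) (W2 :: 'm hmat) =
     lam_minus h W1 W2 - max (eig CARD('m) (- imbalance h W1 W2)) 0"

definition beta1 ::
  "real \<Rightarrow> real \<Rightarrow> real ^ 'm ^ 'n \<Rightarrow> nat \<Rightarrow> 'n::finite hmat \<Rightarrow> 'm::finite hmat \<Rightarrow> real" where
  "beta1 K \<mu> Wstar h W1 W2 =
     max 0 (sigma_min Wstar - sqrt (K / \<mu>) * norm (W_prod h W1 W2 - Wstar))"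

definition beta2 ::
  "real \<Rightarrow> real \<Rightarrow> real ^ 'm ^ 'n \<Rightarrow> nat \<Rightarrow> 'n::finite hmat \<Rightarrow> 'm::finite hmat \<Rightarrow> real" where
  "beta2 K \<mu> Wstar h W1 W2 =
     sigma_max Wstar + sqrt (K / \<mu>) * norm (W_prod h W1 W2 - Wstar)"

definition alpha1 ::
  "real \<Rightarrow> real \<Rightarrow> real ^ 'm ^ 'n \<Rightarrow> nat \<Rightarrow> 'n::finite hmat \<Rightarrow> 'm::finite hmat \<Rightarrow> real" where
  "alpha1 K \<mu> Wstar h W1 W2 =
     (- Delta_plus h W1 W2 - Delta_minus h W1 W2
      + sqrt ((Delta_plus h W1 W2 + Delta_low h W1 W2)\<^sup>2 + 4 * (beta1 K \<mu> Wstar h W1 W2)\<^sup>2)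
      + sqrt ((Delta_minus h W1 W2 + Delta_low h W1 W2)\<^sup>2 + 4 * (beta1 K \<mu> Wstar h W1 W2)\<^sup>2)) / 2"

definition alpha2 ::
  "real \<Rightarrow> real \<Rightarrow> real ^ 'm ^ 'n \<Rightarrow> nat \<Rightarrow> 'n::finite hmat \<Rightarrow> 'm::finite hmat \<Rightarrow> real" where
  "alpha2 K \<mu> Wstar h W1 W2 =
     (lam_plus h W1 W2 + sqrt ((lam_plus h W1 W2)\<^sup>2 + 4 * (beta2 K \<mu> Wstar h W1 W2)\<^sup>2)) / 2
     + (lam_minus h W1 W2 + sqrt ((lam_minus h W1 W2)\<^sup>2 + 4 * (beta2 K \<mu> Wstar h W1 W2)\<^sup>2)) / 2"


section \<open>Random initialization\<close>

definition init_entry :: "'n hmat \<Rightarrow> 'm hmat \<Rightarrow> ('n + 'm) \<times> nat \<Rightarrow> real" where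
  "init_entry W1 W2 = (\<lambda>(r, k). case r of Inl i \<Rightarrow> W1 i k | Inr j \<Rightarrow> W2 j k)"

text \<open>
  All \<open>(n + m) h\<close> entries of the two matrices are jointly independent with law
  \<open>N(0, \<sigma>\<^sup>2)\<close>; note that \<open>normal_density\<close> takes the standard deviation.
\<close>

definition iid_normal_init ::
  "'w measure \<Rightarrow> nat \<Rightarrow> real \<Rightarrow> ('w \<Rightarrow> 'n::finite hmat) \<Rightarrow> ('w \<Rightarrow> 'm::finite hmat) \<Rightarrow> bool" where
  "iid_normal_init M h \<sigma> W1 W2 \<longleftrightarrow>
     prob_space.indep_vars M (\<lambda>_. borel) (\<lambda>e \<omega>. init_entry (W1 \<omega>) (W2 \<omega>) e) (UNIV \<times> {..<h}) \<and>
     (\<forall>e \<in> UNIV \<times> {..<h}.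
        distributed M lborel (\<lambda>\<omega>. init_entry (W1 \<omega>) (W2 \<omega>) e) (\<lambda>x. ennreal (normal_density 0 \<sigma> x)))"

end

theory Submission
  imports Defs
begin

text \<open>
  Put \<open>s = h\<^sup>1\<^sup>-\<^sup>2\<^sup>p\<close>. By Chebyshev's inequality and \<open>p > 1/4\<close>, with probability at least \<open>1 - \<delta>\<close> the matrices
  \<open>W1 W1\<^sup>T - s I\<close>, \<open>W2 W2\<^sup>T - s I\<close> and \<open>W1 W2\<^sup>T\<close> all have norm at most a fixed \<open>\<epsilon>\<close>. On this event the
  \<open>n\<close> largest eigenvalues of \<open>D(0)\<close> and the \<open>m\<close> largest eigenvalues of \<open>-D(0)\<close> are within \<open>3\<epsilon>\<close> of \<open>s\<close>,
  whence \<open>\<alpha>\<^sub>1 \<ge> 2s - 6\<epsilon>\<close> and \<open>\<alpha>\<^sub>2 \<le> 2s + O(1)\<close>; this is the second inequality.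

  For the first one, the eigenvalues of \<open>T\<^sub>0\<^sup>*T\<^sub>0\<close> lie between \<open>\<Delta> = \<lambda>\<^sub>n(D(0))\<^sup>+ + \<lambda>\<^sub>m(-D(0))\<^sup>+\<close> and the value \<open>F\<close>
  that the formula for \<open>\<alpha>\<^sub>2\<close> takes with \<open>w = \<parallel>W(0)\<parallel>\<^sub>F\<close> in place of \<open>\<beta>\<^sub>2\<close>. If \<open>n \<noteq> m\<close> then \<open>\<alpha>\<^sub>1\<close> may exceed the
  least eigenvalue, but only by \<open>2\<beta>\<^sub>1\<^sup>2/\<Delta>\<close> with \<open>\<beta>\<^sub>1 \<le> w\<close>. Either \<open>W\<^sup>* = 0\<close>, and then \<open>\<beta>\<^sub>1 = 0\<close>, or \<open>w\<close> is small
  compared with \<open>\<sigma>\<^sub>m\<^sub>a\<^sub>x(W\<^sup>*) \<le> \<beta>\<^sub>2\<close>, and then the excess is compensated by \<open>\<alpha>\<^sub>2 - F\<close>; in both cases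
  \<open>\<alpha>\<^sub>1 F \<le> \<Delta> \<alpha>\<^sub>2\<close>. Finally a ratio in \<open>[0, 1]\<close> is at most its square root.
\<close>

section \<open>Truncated vectors and symmetric forms\<close>

text \<open>
  The width \<open>h\<close> is a variable, so a vector of length \<open>h\<close> is a function on \<open>nat\<close> of which only
  the arguments \<open>k < h\<close> count, and compactness of the unit sphere is obtained in the product topology.
\<close>

definition trunc_inner :: "nat \<Rightarrow> (nat \<Rightarrow> real) \<Rightarrow> (nat \<Rightarrow> real) \<Rightarrow> real" where
  "trunc_inner h u v = (\<Sum>k<h. u k * v k)"

definition mat_app :: "nat \<Rightarrow> (nat \<Rightarrow> nat \<Rightarrow> real) \<Rightarrow> (nat \<Rightarrow> real) \<Rightarrow> nat \<Rightarrow> real" where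
  "mat_app h a v = (\<lambda>k. \<Sum>l<h. a k l * v l)"

definition qform :: "nat \<Rightarrow> (nat \<Rightarrow> nat \<Rightarrow> real) \<Rightarrow> (nat \<Rightarrow> real) \<Rightarrow> real" where
  "qform h a v = trunc_inner h v (mat_app h a v)"

definition lincomb :: "nat \<Rightarrow> (nat \<Rightarrow> real) \<Rightarrow> (nat \<Rightarrow> nat \<Rightarrow> real) \<Rightarrow> nat \<Rightarrow> real" where
  "lincomb n c L = (\<lambda>k. \<Sum>j<n. c j * L j k)"

lemma trunc_inner_commute: "trunc_inner h u v = trunc_inner h v u"
  by (simp add: trunc_inner_def mult.commute)

lemma trunc_inner_nonneg: "trunc_inner h v v \<ge> 0"
  by (simp add: trunc_inner_def sum_nonneg)

lemma trunc_inner_add_left: "trunc_inner h (\<lambda>k. u k + v k) w = trunc_inner h u w + trunc_inner h v w"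
  by (simp add: trunc_inner_def algebra_simps sum.distrib)

lemma trunc_inner_scale_left: "trunc_inner h (\<lambda>k. c * u k) w = c * trunc_inner h u w"
  by (simp add: trunc_inner_def algebra_simps sum_distrib_left)

lemma trunc_inner_add_right: "trunc_inner h w (\<lambda>k. u k + v k) = trunc_inner h w u + trunc_inner h w v"
  by (simp add: trunc_inner_def algebra_simps sum.distrib)

lemma trunc_inner_scale_right: "trunc_inner h w (\<lambda>k. c * u k) = c * trunc_inner h w u"
  by (simp add: trunc_inner_def algebra_simps sum_distrib_left)

lemma trunc_inner_sum_right: "trunc_inner h w (\<lambda>k. \<Sum>j\<in>J. f j k) = (\<Sum>j\<in>J. trunc_inner h w (f j))"
  unfolding trunc_inner_def by (simp add: sum_distrib_left sum.swap[of _ J])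

lemma trunc_inner_cong: "(\<And>k. k < h \<Longrightarrow> u k = u' k) \<Longrightarrow> (\<And>k. k < h \<Longrightarrow> v k = v' k) \<Longrightarrow> trunc_inner h u v = trunc_inner h u' v'"
  by (simp add: trunc_inner_def)

lemma trunc_inner_eq_0_iff: "trunc_inner h v v = 0 \<longleftrightarrow> (\<forall>k<h. v k = 0)"
  by (auto simp: trunc_inner_def sum_nonneg_eq_0_iff)

lemma trunc_inner_Cauchy_Schwarz: "(trunc_inner h u v)\<^sup>2 \<le> trunc_inner h u u * trunc_inner h v v"
  using Cauchy_Schwarz_ineq_sum[of u v "{..<h}"] by (simp add: trunc_inner_def power2_eq_square)

lemma mat_app_lin: "mat_app h a (\<lambda>k. u k + c * v k) = (\<lambda>k. mat_app h a u k + c * mat_app h a v k)"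
  by (simp add: mat_app_def fun_eq_iff algebra_simps sum.distrib sum_distrib_left)

definition symm_on :: "nat \<Rightarrow> (nat \<Rightarrow> nat \<Rightarrow> real) \<Rightarrow> bool" where
  "symm_on h a \<longleftrightarrow> (\<forall>k<h. \<forall>l<h. a k l = a l k)"

lemma mat_app_selfadjoint:
  assumes "symm_on h a"
  shows "trunc_inner h u (mat_app h a v) = trunc_inner h (mat_app h a u) v"
proof -
  have "trunc_inner h u (mat_app h a v) = (\<Sum>k<h. \<Sum>l<h. u k * a k l * v l)"
    by (simp add: trunc_inner_def mat_app_def sum_distrib_left mult_ac)
  also have "\<dots> = (\<Sum>l<h. \<Sum>k<h. u k * a k l * v l)"
    by (rule sum.swap)
  also have "\<dots> = (\<Sum>l<h. \<Sum>k<h. a l k * u k * v l)"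
    using assms by (intro sum.cong refl) (simp add: symm_on_def mult_ac)
  also have "\<dots> = trunc_inner h (mat_app h a u) v"
    by (simp add: trunc_inner_def mat_app_def sum_distrib_right)
  finally show ?thesis .
qed

text \<open>Fewer than \<open>h\<close> linear conditions on \<open>h\<close> unknowns have a
  nonzero solution: the square matrix with rows \<open>b 0, ..., b (k - 1)\<close> and zero rows
  below is singular, and a kernel vector is normalised. Vanishing from \<open>h\<close> on makes
  \<open>v\<close> a unique representative, as compactness requires later.\<close>

lemma ex_orthogonal:
  assumes "k < h"
  shows "\<exists>v. trunc_inner h v v = 1 \<and> (\<forall>i\<ge>h. v i = 0) \<and> (\<forall>j<k. trunc_inner h (b j) v = 0)"
proof -
  define A where "A = Matrix.mat h h (\<lambda>(i, l). if i < k then b i l else 0)"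
  have A: "A \<in> carrier_mat h h" by (simp add: A_def)
  \<comment> \<open>Row \<open>k\<close> is singled out as a zero row, so the determinant
    vanishes.\<close>
  have "A = mat\<^sub>r h h (\<lambda>i. if i = k then 0\<^sub>v h else vec h (\<lambda>l. if i < k then b i l else 0))"
    by (intro eq_matI) (auto simp: A_def)
  then have "det A = 0"
    using det_row_0[OF assms, of "\<lambda>i. vec h (\<lambda>l. if i < k then b i l else 0)"] by simp
  then obtain w where w: "w \<in> carrier_vec h" "w \<noteq> 0\<^sub>v h" "A *\<^sub>v w = 0\<^sub>v h"
    using det_0_iff_vec_prod_zero[OF A] by blast
  define u where "u = (\<lambda>i. if i < h then vec_index w i else 0)"
  have orth: "trunc_inner h (b j) u = 0" if "j < k" for j
  proof -
    have "vec_index (A *\<^sub>v w) j = 0" using w(3) that assms by simp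
    then show ?thesis
      using that assms w(1) by (auto simp: A_def scalar_prod_def trunc_inner_def u_def atLeast0LessThan)
  qed
  have "\<exists>i<h. u i \<noteq> 0"
  proof (rule ccontr)
    assume "\<not> ?thesis"
    then have "w = 0\<^sub>v h" using w(1) by (intro eq_vecI) (auto simp: u_def)
    with w(2) show False by simp
  qed
  then have pos: "trunc_inner h u u > 0"
    using trunc_inner_nonneg[of h u] trunc_inner_eq_0_iff[of h u] by fastforce
  define v where "v = (\<lambda>i. (1 / sqrt (trunc_inner h u u)) * u i)"
  have "trunc_inner h v v = 1"
    unfolding v_def trunc_inner_scale_left trunc_inner_scale_right using pos by (simp add: field_simps)
  moreover have "\<forall>i\<ge>h. v i = 0" by (simp add: v_def u_def)
  moreover have "\<forall>j<k. trunc_inner h (b j) v = 0"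
    unfolding v_def trunc_inner_scale_right using orth by simp
  ultimately show ?thesis by blast
qed

lemma closed_Collect_ball:
  assumes "\<And>i. i \<in> T \<Longrightarrow> closed {v. P i v}"
  shows "closed {v. \<forall>i\<in>T. P i v}"
  using assms by (simp add: Collect_ball_eq closed_INT)

text \<open>The unit sphere of the orthogonal complement of \<open>b 0, ..., b (k - 1)\<close> is
  compact and nonempty, so the quadratic form attains its maximum there; homogeneity extends the
  bound to the whole complement.\<close>

lemma ex_rayleigh_max:
  assumes "k < h"
  shows "\<exists>v. trunc_inner h v v = 1 \<and> (\<forall>i\<ge>h. v i = 0) \<and> (\<forall>j<k. trunc_inner h (b j) v = 0) \<and>
    (\<forall>w. (\<forall>j<k. trunc_inner h (b j) w = 0) \<longrightarrow> qform h a w \<le> qform h a v * trunc_inner h w w)"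
proof -
  define S where "S = {v. trunc_inner h v v = 1 \<and> (\<forall>i\<in>{h..}. v i = 0) \<and> (\<forall>j\<in>{..<k}. trunc_inner h (b j) v = 0)}"
  \<comment> \<open>Compact by Tychonoff; the factors beyond \<open>h\<close> are the single point
    0.\<close>
  define B where "B = Pi\<^sub>E UNIV (\<lambda>i. if i < h then {-1..1::real} else {0})"
  have "compactin (product_topology (\<lambda>_. euclidean) UNIV) B"
    unfolding B_def compactin_PiE by simp
  then have "compact B" by (simp add: euclidean_product_topology)
  have "closed S"
    unfolding S_def trunc_inner_def
    by (intro closed_Collect_conj closed_Collect_ball closed_Collect_eq continuous_intros continuous_on_product_coordinates)
  moreover have "S \<subseteq> B"
  proof
    fix v assume v: "v \<in> S"
    have "\<bar>v i\<bar> \<le> 1" if "i < h" for i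
    proof -
      have "v i * v i \<le> (\<Sum>k<h. v k * v k)"
        using that by (intro member_le_sum) auto
      then have "(v i)\<^sup>2 \<le> 1" using v by (simp add: S_def trunc_inner_def power2_eq_square)
      then show ?thesis by (simp add: abs_square_le_1)
    qed
    then show "v \<in> B" using v by (auto simp: B_def S_def abs_le_iff minus_le_iff)
  qed
  ultimately have "compact S"
    using \<open>compact B\<close> compact_Int_closed[of B S] by (simp add: Int_absorb1)
  moreover have "S \<noteq> {}"
    using ex_orthogonal[OF assms, of b] by (auto simp: S_def)
  moreover have "continuous_on S (qform h a)"
    unfolding qform_def trunc_inner_def mat_app_def
    by (intro continuous_intros continuous_on_subset[OF continuous_on_product_coordinates]) auto
  ultimately obtain v where v: "v \<in> S" "\<And>w. w \<in> S \<Longrightarrow> qform h a w \<le> qform h a v"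
    using continuous_attains_sup[of S "qform h a"] by blast
  have "qform h a w \<le> qform h a v * trunc_inner h w w" if w: "\<forall>j<k. trunc_inner h (b j) w = 0" for w
  proof (cases "trunc_inner h w w = 0")
    case True
    then have "\<forall>k<h. w k = 0" by (simp add: trunc_inner_eq_0_iff)
    then have "qform h a w = 0" by (simp add: qform_def trunc_inner_def)
    with True show ?thesis by simp
  next
    case False
    then have pos: "trunc_inner h w w > 0" using trunc_inner_nonneg[of h w] by linarith
    define r where "r = 1 / sqrt (trunc_inner h w w)"
    have r: "r * (r * trunc_inner h w w) = 1" using pos by (simp add: r_def field_simps)
    \<comment> \<open>Cutting off at \<open>h\<close> puts \<open>u\<close> into \<open>S\<close>
      and changes neither inner products nor the quadratic form.\<close>
    define u where "u = (\<lambda>i. if i < h then r * w i else 0)"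
    have u: "trunc_inner h x u = r * trunc_inner h x w" for x
      by (simp add: u_def trunc_inner_def sum_distrib_left mult_ac)
    have "trunc_inner h u u = 1"
      using r by (simp only: u trunc_inner_commute[of h u w])
    then have "u \<in> S"
      using w by (auto simp: S_def u) (simp_all add: u_def)
    from v(2)[OF this] have le: "qform h a u \<le> qform h a v" .
    have "mat_app h a u l = r * mat_app h a w l" for l
      by (simp add: mat_app_def u_def sum_distrib_left mult_ac)
    then have "mat_app h a u = (\<lambda>l. r * mat_app h a w l)" by auto
    then have "qform h a u = r * (r * qform h a w)"
      by (simp only: qform_def trunc_inner_scale_right trunc_inner_commute[of h u] u) (simp only: trunc_inner_commute)
    then have "qform h a u * trunc_inner h w w = qform h a w * (r * (r * trunc_inner h w w))"
      by simp
    then have "qform h a w = qform h a u * trunc_inner h w w" using r by simp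
    then show ?thesis using le pos by simp
  qed
  with v show ?thesis by (intro exI[of _ v]) (auto simp: S_def)
qed

section \<open>Spectral theorem and min-max estimates for symmetric matrices\<close>

text \<open>First variation. The residual \<open>w = A v - lam v\<close> is orthogonal to
  \<open>v\<close>, and also to every \<open>b j\<close> because these are eigenvectors, so
  \<open>v + t w\<close> is an admissible competitor. Maximality then bounds
  \<open>2 t |w|^2\<close> by a multiple of \<open>t^2\<close>, which forces
  \<open>w = 0\<close>.\<close>

lemma rayleigh_max_eigenvector:
  assumes sym: "symm_on h a"
    and v: "trunc_inner h v v = 1" "\<forall>j<k. trunc_inner h (b j) v = 0"
    and max: "\<And>w. \<forall>j<k. trunc_inner h (b j) w = 0 \<Longrightarrow> qform h a w \<le> qform h a v * trunc_inner h w w"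
    and b: "\<And>j r. j < k \<Longrightarrow> r < h \<Longrightarrow> mat_app h a (b j) r = e j * b j r"
    and r: "r < h"
  shows "mat_app h a v r = qform h a v * v r"
proof -
  define lam where "lam = qform h a v"
  define w where "w = (\<lambda>r. mat_app h a v r + (- lam) * v r)"
  have vw: "trunc_inner h v w = 0"
    unfolding w_def trunc_inner_add_right trunc_inner_scale_right using v(1) by (simp add: lam_def qform_def)
  have wb: "trunc_inner h (b j) w = 0" if "j < k" for j
  proof -
    have "trunc_inner h (b j) (mat_app h a v) = trunc_inner h (\<lambda>r. e j * b j r) v"
      unfolding mat_app_selfadjoint[OF sym] by (rule trunc_inner_cong) (use b[OF that] in auto)
    then show ?thesis
      unfolding w_def trunc_inner_add_right trunc_inner_scale_right using v(2) that by (simp add: trunc_inner_scale_left)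
  qed
  have vAw: "trunc_inner h v (mat_app h a w) = trunc_inner h w w"
  proof -
    have "trunc_inner h v (mat_app h a w) = trunc_inner h (mat_app h a v) w"
      by (rule mat_app_selfadjoint[OF sym])
    also have "\<dots> = trunc_inner h w (mat_app h a v)" by (rule trunc_inner_commute)
    also have "\<dots> = trunc_inner h w w"
    proof -
      have "trunc_inner h w w = trunc_inner h w (mat_app h a v) + (- lam) * trunc_inner h w v"
        by (subst (2) w_def) (simp only: trunc_inner_add_right trunc_inner_scale_right)
      then show ?thesis using vw by (simp add: trunc_inner_commute[of h w v])
    qed
    finally show ?thesis .
  qed
  have ineq: "2 * t * trunc_inner h w w + t\<^sup>2 * qform h a w \<le> lam * t\<^sup>2 * trunc_inner h w w" for t
  proof -
    let ?u = "\<lambda>r. v r + t * w r"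
    have "qform h a ?u \<le> lam * trunc_inner h ?u ?u"
      unfolding lam_def using v(2) wb by (intro max) (simp add: trunc_inner_add_right trunc_inner_scale_right)
    moreover have "trunc_inner h w (mat_app h a v) = trunc_inner h v (mat_app h a w)"
      using mat_app_selfadjoint[OF sym, of v w] trunc_inner_commute[of h w] by metis
    then have "qform h a ?u = lam + 2 * t * trunc_inner h w w + t\<^sup>2 * qform h a w"
      unfolding qform_def mat_app_lin trunc_inner_add_left trunc_inner_add_right trunc_inner_scale_left trunc_inner_scale_right
      using vAw by (simp add: lam_def qform_def power2_eq_square algebra_simps)
    moreover have "trunc_inner h ?u ?u = 1 + t\<^sup>2 * trunc_inner h w w"
      unfolding trunc_inner_add_left trunc_inner_add_right trunc_inner_scale_left trunc_inner_scale_right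
      using vw v(1) by (simp add: trunc_inner_commute[of h w v] power2_eq_square)
    ultimately show ?thesis by (simp add: algebra_simps)
  qed
  have "trunc_inner h w w = 0"
  proof (rule ccontr)
    assume "trunc_inner h w w \<noteq> 0"
    then have pos: "trunc_inner h w w > 0" using trunc_inner_nonneg[of h w] by linarith
    define M where "M = \<bar>lam * trunc_inner h w w - qform h a w\<bar> + 1"
    have M: "M > 0" by (simp add: M_def)
    \<comment> \<open>With this \<open>t\<close> the quadratic term is at most
      \<open>t * |w|^2\<close>, half of the linear one.\<close>
    define t where "t = trunc_inner h w w / M"
    have t: "t > 0" using pos M by (simp add: t_def)
    have "2 * t * trunc_inner h w w \<le> t\<^sup>2 * (lam * trunc_inner h w w - qform h a w)"
      using ineq[of t] by (simp add: algebra_simps)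
    also have "\<dots> \<le> t\<^sup>2 * M"
      by (intro mult_left_mono) (simp_all add: M_def)
    also have "\<dots> = t * trunc_inner h w w"
      using M by (simp add: t_def power2_eq_square)
    finally show False using t pos by (simp add: mult_le_cancel_right)
  qed
  then have "w r = 0" using r by (simp add: trunc_inner_eq_0_iff)
  then show ?thesis by (simp add: w_def lam_def)
qed

text \<open>The third clause records how the vectors are found: \<open>e i\<close> bounds the
  Rayleigh quotient on the complement of the preceding vectors. It yields the ordering of the
  \<open>e i\<close> and the upper half of the min-max principle without expanding vectors in the
  basis.\<close>

definition eigenbasis :: "nat \<Rightarrow> (nat \<Rightarrow> nat \<Rightarrow> real) \<Rightarrow> nat \<Rightarrow> (nat \<Rightarrow> nat \<Rightarrow> real) \<Rightarrow> (nat \<Rightarrow> real) \<Rightarrow> bool" where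
  "eigenbasis h a k b e \<longleftrightarrow>
     (\<forall>i<k. \<forall>j<k. trunc_inner h (b i) (b j) = of_bool (i = j)) \<and>
     (\<forall>i<k. \<forall>r<h. mat_app h a (b i) r = e i * b i r) \<and>
     (\<forall>i<k. \<forall>w. (\<forall>j<i. trunc_inner h (b j) w = 0) \<longrightarrow> qform h a w \<le> e i * trunc_inner h w w)"

text \<open>Induction on \<open>k\<close>: the next vector maximises the Rayleigh quotient on the
  complement of those already found.\<close>

lemma ex_eigenbasis:
  assumes sym: "symm_on h a"
  shows "k \<le> h \<Longrightarrow> \<exists>b e. eigenbasis h a k b e"
proof (induction k)
  case 0
  show ?case by (simp add: eigenbasis_def)
next
  case (Suc k)
  then obtain b e where be: "eigenbasis h a k b e" by auto
  from ex_rayleigh_max[of k h b a] Suc.prems obtain v where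
    v: "trunc_inner h v v = 1" "\<forall>j<k. trunc_inner h (b j) v = 0"
      "\<And>w. \<forall>j<k. trunc_inner h (b j) w = 0 \<Longrightarrow> qform h a w \<le> qform h a v * trunc_inner h w w"
    by (meson Suc_le_lessD)
  have ev: "\<And>r. r < h \<Longrightarrow> mat_app h a v r = qform h a v * v r"
    using rayleigh_max_eigenvector[OF sym v, of e] be by (simp add: eigenbasis_def)
  have "eigenbasis h a (Suc k) (b(k := v)) (e(k := qform h a v))"
    unfolding eigenbasis_def
  proof (intro conjI allI impI)
    fix i j assume "i < Suc k" "j < Suc k"
    then show "trunc_inner h ((b(k := v)) i) ((b(k := v)) j) = of_bool (i = j)"
      using be v(1,2) by (cases "i = k"; cases "j = k") (auto simp: eigenbasis_def trunc_inner_commute[of h v "b _"])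
  next
    fix i r assume "i < Suc k" "r < h"
    then show "mat_app h a ((b(k := v)) i) r = (e(k := qform h a v)) i * (b(k := v)) i r"
      using be ev by (cases "i = k") (auto simp: eigenbasis_def)
  next
    fix i w assume i: "i < Suc k" and w: "\<forall>j<i. trunc_inner h ((b(k := v)) j) w = 0"
    have "\<forall>j<i. trunc_inner h (b j) w = 0"
      using w i by (auto split: if_splits)
    then show "qform h a w \<le> (e(k := qform h a v)) i * trunc_inner h w w"
      using be v(3)[of w] i by (cases "i = k") (auto simp: eigenbasis_def)
  qed
  then show ?case by blast
qed

text \<open>The bound attached to index \<open>i\<close> applies to the later vector
  \<open>b j\<close>, whose Rayleigh quotient is \<open>e j\<close>.\<close>

lemma eigenbasis_sorted:
  assumes be: "eigenbasis h a k b e" and "i \<le> j" "j < k"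
  shows "e j \<le> e i"
proof (cases "i = j")
  case False
  then have "i < j" using assms by simp
  have "qform h a (b j) = trunc_inner h (b j) (\<lambda>r. e j * b j r)"
    unfolding qform_def using be \<open>j < k\<close> by (intro trunc_inner_cong) (auto simp: eigenbasis_def)
  also have "\<dots> = e j"
    using be \<open>j < k\<close> by (simp add: trunc_inner_scale_right eigenbasis_def)
  finally have "qform h a (b j) = e j" .
  have "\<forall>w. (\<forall>l<i. trunc_inner h (b l) w = 0) \<longrightarrow> qform h a w \<le> e i * trunc_inner h w w"
    using be \<open>i < j\<close> \<open>j < k\<close> by (simp add: eigenbasis_def)
  moreover have "trunc_inner h (b l) (b j) = 0" if "l < i" for l
    using be \<open>i < j\<close> \<open>j < k\<close> that by (auto simp: eigenbasis_def)
  ultimately have "qform h a (b j) \<le> e i * trunc_inner h (b j) (b j)" by blast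
  with \<open>qform h a (b j) = e j\<close> show ?thesis using be \<open>j < k\<close> by (simp add: eigenbasis_def)
qed simp

text \<open>The matrix \<open>P\<close> with columns \<open>b j\<close> diagonalises
  \<open>A\<close>, so the characteristic polynomial splits with roots
  \<open>e 0, ..., e (h - 1)\<close>, already in decreasing order. The basis counts from 0 and
  \<open>eig\<close> from 1.\<close>

lemma eigenbasis_eig:
  assumes be: "eigenbasis h a h b e" and i: "i < h"
  shows "eig (Suc i) (Matrix.mat h h (\<lambda>(k, l). a k l)) = e i"
proof -
  define A where "A = Matrix.mat h h (\<lambda>(k, l). a k l)"
  define P where "P = Matrix.mat h h (\<lambda>(k, j). b j k)"
  define Q where "Q = Matrix.mat h h (\<lambda>(j, k). b j k)"
  define E where "E = Matrix.mat h h (\<lambda>(k, j). if k = j then e j else 0)"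
  have carr: "A \<in> carrier_mat h h" "P \<in> carrier_mat h h" "Q \<in> carrier_mat h h" "E \<in> carrier_mat h h"
    by (simp_all add: A_def P_def Q_def E_def)
  have QP: "Q * P = 1\<^sub>m h"
    using be by (intro eq_matI)
      (auto simp: Q_def P_def scalar_prod_def eigenbasis_def trunc_inner_def atLeast0LessThan)
  then have PQ: "P * Q = 1\<^sub>m h"
    using mat_mult_left_right_inverse carr by blast
  have "A * P = P * E"
  proof (intro eq_matI)
    fix k j assume kj: "k < dim_row (P * E)" "j < dim_col (P * E)"
    then have kj: "k < h" "j < h" using carr by auto
    have "(A * P) $$ (k, j) = mat_app h a (b j) k"
      using kj by (simp add: A_def P_def scalar_prod_def mat_app_def atLeast0LessThan)
    also have "\<dots> = b j k * e j" using be kj by (simp add: eigenbasis_def)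
    also have "\<dots> = (\<Sum>i<h. if i = j then b i k * e j else 0)"
      using kj by simp
    also have "\<dots> = (P * E) $$ (k, j)"
      using kj by (simp add: P_def E_def scalar_prod_def atLeast0LessThan if_distrib cong: if_cong)
    finally show "(A * P) $$ (k, j) = (P * E) $$ (k, j)" .
  qed (use carr in auto)
  then have "A = P * E * Q"
    using carr PQ by (metis assoc_mult_mat right_mult_one_mat)
  then have "similar_mat A E"
    using carr PQ QP by (intro similar_matI[where n = h and P = P and Q = Q]) auto
  then have "char_poly A = char_poly E" by (rule char_poly_similar)
  also have "\<dots> = (\<Prod>a\<leftarrow>diag_mat E. [:- a, 1:])"
    using carr by (intro char_poly_upper_triangular[where n = h]) (auto simp: E_def)
  also have "diag_mat E = map e [0..<h]"
    by (auto simp: diag_mat_def E_def)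
  finally have "char_poly A = (\<Prod>p\<leftarrow>map (\<lambda>i. [:- e i, 1:]) [0..<h]. p)"
    by (simp add: o_def)
  then have "proots (char_poly A) = (\<Sum>p\<leftarrow>map (\<lambda>i. [:- e i, 1:]) [0..<h]. proots p)"
    by (simp only:) (intro proots_prod_list, auto)
  also have "\<dots> = (\<Sum>i\<leftarrow>[0..<h]. {#e i#})"
    by (simp add: o_def)
  also have "\<dots> = mset (map e [0..<h])"
    by (induction h) auto
  \<comment> \<open>The list is reversed because sorting produces the increasing order, which
    \<open>eig\<close> reverses back.\<close>
  finally have pr: "proots (char_poly A) = mset (rev (map e [0..<h]))" by simp
  have "sorted (rev (map e [0..<h]))"
    unfolding sorted_rev_iff_nth_mono
    using eigenbasis_sorted[OF be] by auto
  then have "sorted_list_of_multiset (proots (char_poly A)) = rev (map e [0..<h])"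
    unfolding pr by (simp only: sorted_list_of_multiset_mset sorted_sort_id)
  then show ?thesis using i by (simp add: eig_def A_def[symmetric])
qed

section \<open>The two halves of the Courant-Fischer principle, and Weyl's inequality\<close>

lemma trunc_inner_lincomb_left: "trunc_inner h (lincomb n c L) w = (\<Sum>j<n. c j * trunc_inner h (L j) w)"
  unfolding lincomb_def trunc_inner_commute[of h _ w] trunc_inner_sum_right trunc_inner_scale_right ..

definition orthonormal_family :: "nat \<Rightarrow> nat \<Rightarrow> (nat \<Rightarrow> nat \<Rightarrow> real) \<Rightarrow> bool" where
  "orthonormal_family h n L \<longleftrightarrow> (\<forall>i<n. \<forall>j<n. trunc_inner h (L i) (L j) = of_bool (i = j))"

lemma trunc_inner_lincomb_coeff:
  assumes "orthonormal_family h n L" "i < n"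
  shows "trunc_inner h (L i) (lincomb n c L) = c i"
proof -
  have "trunc_inner h (L i) (lincomb n c L) = (\<Sum>j<n. c j * trunc_inner h (L j) (L i))"
    by (subst trunc_inner_commute) (rule trunc_inner_lincomb_left)
  also have "\<dots> = (\<Sum>j<n. if j = i then c j else 0)"
    using assms by (intro sum.cong) (auto simp: orthonormal_family_def)
  finally show ?thesis using assms by simp
qed

lemma trunc_inner_lincomb_orthonormal:
  assumes "orthonormal_family h n L"
  shows "trunc_inner h (lincomb n c L) (lincomb n c L) = (\<Sum>j<n. (c j)\<^sup>2)"
  unfolding trunc_inner_lincomb_left using trunc_inner_lincomb_coeff[OF assms, of _ c]
  by (simp add: power2_eq_square)

text \<open>The witness is the span of the first \<open>n\<close> eigenvectors, where every
  eigenvalue involved is at least the \<open>n\<close>-th.\<close>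

lemma eig_attained_on_subspace:
  assumes sym: "symm_on h a"
    and n: "0 < n" "n \<le> h"
  shows "\<exists>L. orthonormal_family h n L \<and>
    (\<forall>c. eig n (Matrix.mat h h (\<lambda>(k, l). a k l)) * trunc_inner h (lincomb n c L) (lincomb n c L)
          \<le> qform h a (lincomb n c L))"
proof -
  obtain b e where be: "eigenbasis h a h b e" using ex_eigenbasis[OF sym] by blast
  have eig: "eig n (Matrix.mat h h (\<lambda>(k, l). a k l)) = e (n - 1)"
    using eigenbasis_eig[OF be, of "n - 1"] n by simp
  have orth: "orthonormal_family h n b"
    using be n by (simp add: eigenbasis_def orthonormal_family_def)
  have "e (n - 1) * trunc_inner h (lincomb n c b) (lincomb n c b) \<le> qform h a (lincomb n c b)" for c
  proof -
    have "mat_app h a (lincomb n c b) r = lincomb n (\<lambda>j. c j * e j) b r" if "r < h" for r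
    proof -
      have "mat_app h a (lincomb n c b) r = (\<Sum>j<n. c j * mat_app h a (b j) r)"
        unfolding mat_app_def lincomb_def sum_distrib_left
        by (subst sum.swap) (simp add: mult_ac)
      then show ?thesis using be that n by (simp add: lincomb_def eigenbasis_def mult_ac)
    qed
    then have "qform h a (lincomb n c b) = trunc_inner h (lincomb n c b) (lincomb n (\<lambda>j. c j * e j) b)"
      unfolding qform_def by (intro trunc_inner_cong) auto
    also have "\<dots> = (\<Sum>j<n. e j * (c j)\<^sup>2)"
      unfolding trunc_inner_lincomb_left using trunc_inner_lincomb_coeff[OF orth, of _ "\<lambda>j. c j * e j"]
      by (simp add: power2_eq_square mult_ac)
    also have "\<dots> \<ge> (\<Sum>j<n. e (n - 1) * (c j)\<^sup>2)"
      using n by (intro sum_mono mult_right_mono eigenbasis_sorted[OF be]) auto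
    finally show ?thesis
      using trunc_inner_lincomb_orthonormal[OF orth, of c] by (simp add: sum_distrib_left)
  qed
  then show ?thesis using eig orth by (intro exI[of _ b]) simp
qed

text \<open>An \<open>n\<close>-dimensional space contains a nonzero vector orthogonal to the first
  \<open>n - 1\<close> eigenvectors, and there the Rayleigh quotient is at most the
  \<open>n\<close>-th eigenvalue. Positivity of the norms expresses that the \<open>L j\<close> are
  linearly independent.\<close>

lemma eig_geI:
  assumes sym: "symm_on h a"
    and n: "0 < n" "n \<le> h"
    and L: "\<And>c. \<exists>j<n. c j \<noteq> 0 \<Longrightarrow> 0 < trunc_inner h (lincomb n c L) (lincomb n c L) \<and>
      \<gamma> * trunc_inner h (lincomb n c L) (lincomb n c L) \<le> qform h a (lincomb n c L)"
  shows "\<gamma> \<le> eig n (Matrix.mat h h (\<lambda>(k, l). a k l))"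
proof -
  obtain b e where be: "eigenbasis h a h b e" using ex_eigenbasis[OF sym] by blast
  have eig: "eig n (Matrix.mat h h (\<lambda>(k, l). a k l)) = e (n - 1)"
    using eigenbasis_eig[OF be, of "n - 1"] n by simp
  \<comment> \<open>The orthogonality conditions are read as \<open>n - 1\<close> linear conditions
    on the \<open>n\<close> coefficients.\<close>
  obtain c where c: "trunc_inner n c c = 1" "\<forall>i<n - 1. trunc_inner n (\<lambda>j. trunc_inner h (L j) (b i)) c = 0"
    using ex_orthogonal[of "n - 1" n "\<lambda>i j. trunc_inner h (L j) (b i)"] n by auto
  let ?v = "lincomb n c L"
  have "\<exists>j<n. c j \<noteq> 0" using c(1) trunc_inner_eq_0_iff[of n c] by auto
  note Lc = L[OF this]
  have "trunc_inner h (b i) ?v = 0" if "i < n - 1" for i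
    using c(2) that unfolding trunc_inner_commute[of h "b i"] trunc_inner_lincomb_left
    by (auto simp: trunc_inner_def mult_ac)
  then have "qform h a ?v \<le> e (n - 1) * trunc_inner h ?v ?v"
    using be n by (simp add: eigenbasis_def)
  with Lc show ?thesis unfolding eig by (meson mult_le_cancel_right_pos order_trans)
qed

lemma eig_decreasing:
  assumes sym: "symm_on h a"
    and n: "0 < m" "m \<le> n" "n \<le> h"
  shows "eig n (Matrix.mat h h (\<lambda>(k, l). a k l)) \<le> eig m (Matrix.mat h h (\<lambda>(k, l). a k l))"
proof -
  obtain b e where be: "eigenbasis h a h b e" using ex_eigenbasis[OF sym] by blast
  show ?thesis
    using eigenbasis_eig[OF be, of "n - 1"] eigenbasis_eig[OF be, of "m - 1"] n
      eigenbasis_sorted[OF be, of "m - 1" "n - 1"] by simp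
qed

text \<open>Weyl's inequality with the entrywise sum norm, which dominates the change of every
  Rayleigh quotient. It serves only to prove continuity of the eigenvalues, so a crude norm
  suffices.\<close>

lemma eig_perturb:
  assumes sym: "symm_on h a" "symm_on h a'"
    and n: "0 < n" "n \<le> h"
  shows "eig n (Matrix.mat h h (\<lambda>(k, l). a k l)) - (\<Sum>k<h. \<Sum>l<h. \<bar>a k l - a' k l\<bar>)
    \<le> eig n (Matrix.mat h h (\<lambda>(k, l). a' k l))"
proof -
  define S where "S = (\<Sum>k<h. \<Sum>l<h. \<bar>a k l - a' k l\<bar>)"
  have diff: "qform h a v - S * trunc_inner h v v \<le> qform h a' v" for v
  proof -
    have "qform h a v - qform h a' v = (\<Sum>k<h. \<Sum>l<h. (a k l - a' k l) * (v k * v l))"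
      by (simp add: qform_def mat_app_def trunc_inner_def sum_distrib_left sum_subtractf algebra_simps)
    also have "\<dots> \<le> (\<Sum>k<h. \<Sum>l<h. \<bar>a k l - a' k l\<bar> * trunc_inner h v v)"
    proof (intro sum_mono)
      fix k l assume kl: "k \<in> {..<h}" "l \<in> {..<h}"
      have sq: "(v i)\<^sup>2 \<le> trunc_inner h v v" if "i < h" for i
        unfolding trunc_inner_def power2_eq_square
        using member_le_sum[of i "{..<h}" "\<lambda>k. v k * v k"] that by auto
      have "2 * \<bar>v k * v l\<bar> \<le> (v k)\<^sup>2 + (v l)\<^sup>2"
        using sum_squares_bound[of "\<bar>v k\<bar>" "\<bar>v l\<bar>"] by (simp add: abs_mult)
      then have "\<bar>v k * v l\<bar> \<le> trunc_inner h v v"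
        using sq[of k] sq[of l] kl by auto
      then have "\<bar>(a k l - a' k l) * (v k * v l)\<bar> \<le> \<bar>a k l - a' k l\<bar> * trunc_inner h v v"
        unfolding abs_mult[of "a k l - a' k l"] by (intro mult_left_mono) auto
      then show "(a k l - a' k l) * (v k * v l) \<le> \<bar>a k l - a' k l\<bar> * trunc_inner h v v"
        by linarith
    qed
    finally show ?thesis by (simp add: S_def sum_distrib_right)
  qed
  obtain L where L: "orthonormal_family h n L"
    "\<And>c. eig n (Matrix.mat h h (\<lambda>(k, l). a k l)) * trunc_inner h (lincomb n c L) (lincomb n c L)
          \<le> qform h a (lincomb n c L)"
    using eig_attained_on_subspace[OF sym(1) n] by blast
  show ?thesis
    unfolding S_def[symmetric]
  proof (rule eig_geI[OF sym(2) n, where L = L])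
    fix c :: "nat \<Rightarrow> real" assume c: "\<exists>j<n. c j \<noteq> 0"
    have "0 < trunc_inner h (lincomb n c L) (lincomb n c L)"
      unfolding trunc_inner_lincomb_orthonormal[OF L(1)]
      using c by (auto intro: sum_pos2)
    then show "0 < trunc_inner h (lincomb n c L) (lincomb n c L) \<and>
      (eig n (Matrix.mat h h (\<lambda>(k, l). a k l)) - S) * trunc_inner h (lincomb n c L) (lincomb n c L)
        \<le> qform h a' (lincomb n c L)"
      using L(2)[of c] diff[of "lincomb n c L"] by (simp add: algebra_simps)
  qed
qed

section \<open>Self-adjoint operators and singular values\<close>

definition selfadjoint :: "('a::real_inner \<Rightarrow> 'a) \<Rightarrow> bool" where
  "selfadjoint S \<longleftrightarrow> linear S \<and> (\<forall>x y. inner x (S y) = inner (S x) y)"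

lemma selfadjoint_uminus: "selfadjoint S \<Longrightarrow> selfadjoint (\<lambda>x. - S x)"
  by (auto simp: selfadjoint_def linear_compose_neg)

text \<open>Eigenvectors for distinct eigenvalues are orthogonal, and pairwise orthogonal sets in a
  Euclidean space are finite. Finiteness gives \<open>Max\<close> and \<open>Min\<close> of the
  spectrum their meaning.\<close>

lemma finite_operator_eigenvalues:
  fixes S :: "'a::euclidean_space \<Rightarrow> 'a"
  assumes "selfadjoint S"
  shows "finite (operator_eigenvalues S)"
proof -
  define f where "f c = (SOME x. x \<noteq> 0 \<and> S x = c *\<^sub>R x)" for c
  have f: "f c \<noteq> 0" "S (f c) = c *\<^sub>R f c" if "c \<in> operator_eigenvalues S" for c
    using that someI_ex[of "\<lambda>x. x \<noteq> 0 \<and> S x = c *\<^sub>R x"]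
    by (auto simp: operator_eigenvalues_def f_def)
  have orth: "inner (f c) (f d) = 0"
    if "c \<in> operator_eigenvalues S" "d \<in> operator_eigenvalues S" "c \<noteq> d" for c d
  proof -
    have "inner (f c) (S (f d)) = inner (S (f c)) (f d)"
      using assms by (simp add: selfadjoint_def)
    then have "(d - c) * inner (f c) (f d) = 0"
      using f that by (simp add: algebra_simps)
    then show ?thesis using that by simp
  qed
  have "pairwise real_inner_class.orthogonal (f ` operator_eigenvalues S)"
    using orth by (auto simp: pairwise_def real_inner_class.orthogonal_def)
  then have "finite (f ` operator_eigenvalues S)"
    by (rule pairwise_orthogonal_imp_finite)
  moreover have "inj_on f (operator_eigenvalues S)"
    using orth f(1) by (metis inj_onI inner_eq_zero_iff)
  ultimately show ?thesis using finite_imageD by blast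
qed

text \<open>The first variation argument of \<open>rayleigh_max_eigenvector\<close>, without
  constraints.\<close>

lemma ex_max_eigenvector:
  fixes S :: "'a::euclidean_space \<Rightarrow> 'a"
  assumes "selfadjoint S"
  shows "\<exists>x c. norm x = 1 \<and> S x = c *\<^sub>R x \<and> (\<forall>y. inner y (S y) \<le> c * (norm y)\<^sup>2)"
proof -
  have lin: "linear S" and adj: "\<And>x y. inner x (S y) = inner (S x) y"
    using assms by (auto simp: selfadjoint_def)
  have "continuous_on (sphere 0 1) (\<lambda>x. inner x (S x))"
    using linear_continuous_on_compose[OF continuous_on_id lin] by (intro continuous_intros) auto
  moreover have "sphere (0::'a) 1 \<noteq> {}" by simp
  ultimately obtain x where x: "norm x = 1" "\<And>y. norm y = 1 \<Longrightarrow> inner y (S y) \<le> inner x (S x)"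
    using continuous_attains_sup[OF compact_sphere, of 0 1 "\<lambda>x. inner x (S x)"]
    by (auto simp: sphere_def)
  define c where "c = inner x (S x)"
  have le: "inner y (S y) \<le> c * (norm y)\<^sup>2" for y
  proof (cases "y = 0")
    case False
    have "inner ((1 / norm y) *\<^sub>R y) (S ((1 / norm y) *\<^sub>R y)) \<le> c"
      unfolding c_def using False by (intro x(2)) simp
    then show ?thesis
      using False by (simp add: linear_scale[OF lin] field_simps power2_eq_square)
  qed (simp add: linear_0[OF lin])
  have xx: "inner x x = 1" using x(1) by (simp add: dot_square_norm)
  define w where "w = S x - c *\<^sub>R x"
  have xw: "inner x w = 0"
    using x(1) by (simp add: w_def inner_diff_right c_def dot_square_norm)
  have xSw: "inner x (S w) = (norm w)\<^sup>2"
  proof -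
    have "inner x (S w) = inner (w + c *\<^sub>R x) w" unfolding adj by (simp add: w_def)
    then show ?thesis using xw by (simp add: inner_add_left dot_square_norm)
  qed
  have ineq: "2 * t * (norm w)\<^sup>2 \<le> t\<^sup>2 * (c * (norm w)\<^sup>2 - inner w (S w))" for t
  proof -
    have "inner (x + t *\<^sub>R w) (S (x + t *\<^sub>R w)) = c + 2 * t * (norm w)\<^sup>2 + t\<^sup>2 * inner w (S w)"
      using xSw adj[of w x]
      by (simp add: linear_add[OF lin] linear_scale[OF lin] inner_add_left inner_add_right c_def
          inner_commute[of "S w" x] power2_eq_square algebra_simps)
    moreover have "(norm (x + t *\<^sub>R w))\<^sup>2 = 1 + t\<^sup>2 * (norm w)\<^sup>2"
    proof -
      have "(norm (x + t *\<^sub>R w))\<^sup>2 = inner (x + t *\<^sub>R w) (x + t *\<^sub>R w)"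
        by (rule power2_norm_eq_inner)
      also have "\<dots> = inner x x + 2 * t * inner x w + t\<^sup>2 * inner w w"
        by (simp add: inner_add_left inner_add_right inner_commute[of w x] power2_eq_square algebra_simps)
      finally show ?thesis using xx xw by (simp add: dot_square_norm)
    qed
    ultimately show ?thesis using le[of "x + t *\<^sub>R w"] by (simp add: algebra_simps)
  qed
  have "w = 0"
  proof (rule ccontr)
    assume "w \<noteq> 0"
    then have pos: "(norm w)\<^sup>2 > 0" by simp
    define M where "M = \<bar>c * (norm w)\<^sup>2 - inner w (S w)\<bar> + 1"
    have M: "M > 0" by (simp add: M_def)
    define t where "t = (norm w)\<^sup>2 / M"
    have t: "t > 0" using pos M by (simp add: t_def)
    note ineq[of t]
    also have "t\<^sup>2 * (c * (norm w)\<^sup>2 - inner w (S w)) \<le> t\<^sup>2 * M"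
      by (intro mult_left_mono) (simp_all add: M_def)
    also have "\<dots> = t * (norm w)\<^sup>2"
      using M by (simp add: t_def power2_eq_square)
    finally show False using t pos by (simp add: mult_le_cancel_right)
  qed
  then show ?thesis using x(1) le by (auto simp: w_def)
qed

text \<open>The largest eigenvalue is the maximum of the Rayleigh quotient, and the least one is
  treated through \<open>- S\<close>. Bounds on the spectrum thus become bounds on a quadratic
  form.\<close>

lemma
  fixes S :: "'a::euclidean_space \<Rightarrow> 'a"
  assumes S: "selfadjoint S"
  shows operator_eigenvalues_nonempty: "operator_eigenvalues S \<noteq> {}"
    and Max_operator_eigenvalues_le_iff:
      "Max (operator_eigenvalues S) \<le> c \<longleftrightarrow> (\<forall>x. inner x (S x) \<le> c * (norm x)\<^sup>2)"
    and Min_operator_eigenvalues_ge_iff: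
      "c \<le> Min (operator_eigenvalues S) \<longleftrightarrow> (\<forall>x. c * (norm x)\<^sup>2 \<le> inner x (S x))"
proof -
  note fin = finite_operator_eigenvalues[OF S]
  obtain x a where x: "norm x = 1" "S x = a *\<^sub>R x" "\<And>y. inner y (S y) \<le> a * (norm y)\<^sup>2"
    using ex_max_eigenvector[OF S] by blast
  obtain z b where z: "norm z = 1" "- S z = b *\<^sub>R z" "\<And>y. inner y (- S y) \<le> b * (norm y)\<^sup>2"
    using ex_max_eigenvector[OF selfadjoint_uminus[OF S]] by blast
  have a: "a \<in> operator_eigenvalues S" 
    using x by (auto simp: operator_eigenvalues_def intro!: exI[of _ x])
  have b: "- b \<in> operator_eigenvalues S" 
  proof -
    have "S z = (- b) *\<^sub>R z" using z(2) by (metis minus_minus scaleR_minus_left)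
    moreover have "z \<noteq> 0" using z(1) by auto
    ultimately show ?thesis by (auto simp: operator_eigenvalues_def)
  qed
  show ne: "operator_eigenvalues S \<noteq> {}" using a by blast
  have rq: "\<exists>y. norm y = 1 \<and> inner y (S y) = d" if "d \<in> operator_eigenvalues S" for d
  proof -
    obtain y where "y \<noteq> 0" "S y = d *\<^sub>R y"
      using \<open>d \<in> operator_eigenvalues S\<close> by (auto simp: operator_eigenvalues_def)
    then show ?thesis
      using S by (intro exI[of _ "(1 / norm y) *\<^sub>R y"])
        (auto simp: selfadjoint_def linear_scale dot_square_norm power2_eq_square)
  qed
  show "Max (operator_eigenvalues S) \<le> c \<longleftrightarrow> (\<forall>x. inner x (S x) \<le> c * (norm x)\<^sup>2)"
  proof
    assume "Max (operator_eigenvalues S) \<le> c"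
    then have "a \<le> c" using a fin by (meson Max_ge order_trans)
    then show "\<forall>x. inner x (S x) \<le> c * (norm x)\<^sup>2"
      using x(3) by (meson mult_right_mono order_trans zero_le_power2)
  next
    assume le: "\<forall>x. inner x (S x) \<le> c * (norm x)\<^sup>2"
    show "Max (operator_eigenvalues S) \<le> c"
      using rq le by (auto simp: Max_le_iff[OF fin ne]) (metis mult.right_neutral one_power2)
  qed
  show "c \<le> Min (operator_eigenvalues S) \<longleftrightarrow> (\<forall>x. c * (norm x)\<^sup>2 \<le> inner x (S x))"
  proof
    assume "c \<le> Min (operator_eigenvalues S)"
    then have "c \<le> - b" using b fin by (meson Min_le order_trans)
    then have "c * (norm y)\<^sup>2 \<le> - b * (norm y)\<^sup>2" for y
      by (intro mult_right_mono) auto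
    then show "\<forall>x. c * (norm x)\<^sup>2 \<le> inner x (S x)"
      using z(3) by (smt (verit) inner_minus_right mult_minus_left)
  next
    assume le: "\<forall>x. c * (norm x)\<^sup>2 \<le> inner x (S x)"
    show "c \<le> Min (operator_eigenvalues S)"
      using rq le by (auto simp: Min_ge_iff[OF fin ne]) (metis mult.right_neutral one_power2)
  qed
qed

section \<open>Frobenius norm and singular values\<close>

lemma norm_vec_squared: "(norm (x :: ('b::real_inner) ^ 'n::finite))\<^sup>2 = (\<Sum>i\<in>UNIV. (norm (x $ i))\<^sup>2)"
  by (simp add: power2_norm_eq_inner inner_vec_def)

lemma norm_matrix_vector_le:
  fixes A :: "real ^ 'm::finite ^ 'n::finite"
  shows "norm (A *v x) \<le> norm A * norm x"
proof -
  have "(norm (A *v x))\<^sup>2 = (\<Sum>i\<in>UNIV. (inner (A $ i) x)\<^sup>2)"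
    by (simp add: norm_vec_squared matrix_vector_mult_def inner_vec_def)
  also have "\<dots> \<le> (\<Sum>i\<in>UNIV. (norm (A $ i))\<^sup>2 * (norm x)\<^sup>2)"
    by (intro sum_mono) (metis Cauchy_Schwarz_ineq power2_norm_eq_inner)
  also have "\<dots> = (norm A * norm x)\<^sup>2"
    by (simp add: norm_vec_squared[of A] power_mult_distrib sum_distrib_right)
  finally show ?thesis by (rule power2_le_imp_le) simp
qed

lemma norm_transpose: "norm (transpose A) = norm (A :: real ^ 'm::finite ^ 'n::finite)"
proof -
  have "(norm (transpose A))\<^sup>2 = (norm A)\<^sup>2"
    unfolding norm_vec_squared transpose_def by simp (rule sum.swap)
  then show ?thesis by simp
qed

lemma selfadjoint_gram: "selfadjoint (\<lambda>x. transpose A *v ((A :: real ^ 'm::finite ^ 'n::finite) *v x))"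
  unfolding selfadjoint_def
proof (intro conjI allI)
  show "linear (\<lambda>x. transpose A *v (A *v x))"
    by (simp add: matrix_vector_mul_linear matrix_vector_mul_assoc)
  show "inner x (transpose A *v (A *v y)) = inner (transpose A *v (A *v x)) y" for x y
    by (metis dot_lmul_matrix inner_commute vector_transpose_matrix)
qed

lemma singular_value_bounds:
  assumes "s \<in> singular_values A"
  shows "0 \<le> s" "s \<le> norm A"
proof -
  obtain u v where uv: "s \<ge> 0" "norm u = 1" "norm v = 1" "A *v v = s *\<^sub>R u"
    using assms by (auto simp: singular_values_def)
  then have "s = norm (A *v v)" by simp
  also have "\<dots> \<le> norm A" using norm_matrix_vector_le[of A v] uv by simp
  finally show "s \<le> norm A" .
qed (use assms in \<open>auto simp: singular_values_def\<close>)

lemma finite_singular_values: "finite (singular_values A)"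
proof -
  have "(\<lambda>s. s * s) ` singular_values A \<subseteq> operator_eigenvalues (\<lambda>x. transpose A *v (A *v x))"
  proof clarify
    fix s assume "s \<in> singular_values A"
    then obtain u v where "norm v = 1" "A *v v = s *\<^sub>R u" "transpose A *v u = s *\<^sub>R v"
      by (auto simp: singular_values_def)
    then have "v \<noteq> 0" "transpose A *v (A *v v) = (s * s) *\<^sub>R v"
      by (auto simp: matrix_vector_mult_scaleR)
    then show "s * s \<in> operator_eigenvalues (\<lambda>x. transpose A *v (A *v x))"
      by (auto simp: operator_eigenvalues_def)
  qed
  then have "finite ((\<lambda>s. s * s) ` singular_values A)"
    using finite_operator_eigenvalues[OF selfadjoint_gram] finite_subset by blast
  moreover have "inj_on (\<lambda>s. s * s) (singular_values A)"
    using singular_value_bounds(1)[of _ A] by (intro inj_onI) (metis real_sqrt_abs2 abs_of_nonneg)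
  ultimately show ?thesis using finite_imageD by blast
qed

text \<open>For \<open>A \<noteq> 0\<close> a top eigenvector \<open>x\<close> of the Gram operator
  and \<open>u = A x / |A x|\<close> form a singular pair; for \<open>A = 0\<close> any unit vectors
  do. Nonemptiness makes \<open>Min\<close> and \<open>Max\<close> genuine, and positivity makes
  \<open>sigma_max A\<close> positive for \<open>A \<noteq> 0\<close>.\<close>

lemma ex_singular_value: "\<exists>s\<in>singular_values A. A \<noteq> 0 \<longrightarrow> s > 0"
proof (cases "A = 0")
  case True
  have "transpose A = 0" using True by (simp add: transpose_def Finite_Cartesian_Product.vec_eq_iff)
  then have "0 \<in> singular_values A"
    using True unfolding singular_values_def
    by (auto intro!: exI[of _ "axis undefined 1"])
  with True show ?thesis by blast
next
  case False
  obtain x c where x: "norm x = 1" "transpose A *v (A *v x) = c *\<^sub>R x"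
    "\<And>y. inner y (transpose A *v (A *v y)) \<le> c * (norm y)\<^sup>2"
    using ex_max_eigenvector[OF selfadjoint_gram[of A]] by blast
  have gram: "inner y (transpose A *v (A *v y)) = (norm (A *v y))\<^sup>2" for y
    by (metis dot_lmul_matrix inner_commute vector_transpose_matrix dot_square_norm)
  obtain y where "A *v y \<noteq> 0"
    using False by (metis matrix_eq matrix_vector_mult_0)
  then have "0 < c * (norm y)\<^sup>2"
    using x(3)[of y] unfolding gram by (smt (verit) zero_less_power2 norm_eq_zero)
  then have c: "c > 0" by (simp add: zero_less_mult_iff)
  have nA: "(norm (A *v x))\<^sup>2 = c"
    using x(1,2) gram[of x] by (simp add: dot_square_norm)
  define s where "s = norm (A *v x)"
  have s: "s > 0" "s * s = c" using nA c by (auto simp: s_def power2_eq_square)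
  define u where "u = (1 / s) *\<^sub>R (A *v x)"
  have "transpose A *v u = (1 / s) *\<^sub>R ((s * s) *\<^sub>R x)"
    unfolding u_def matrix_vector_mult_scaleR x(2) s(2) ..
  then have "transpose A *v u = s *\<^sub>R x" using s(1) by simp
  moreover have "norm u = 1" "A *v x = s *\<^sub>R u"
    using s(1) by (simp_all add: u_def s_def)
  ultimately have "s \<in> singular_values A"
    unfolding singular_values_def using x(1) s(1) by auto
  with s show ?thesis by blast
qed

lemma sigma_min_le_norm: "sigma_min A \<le> norm A"
  using Min_in[OF finite_singular_values, of A] ex_singular_value[of A] singular_value_bounds(2)[of _ A]
  by (auto simp: sigma_min_def)

lemma sigma_max_nonneg: "0 \<le> sigma_max A"
  using Max_in[OF finite_singular_values, of A] ex_singular_value[of A] singular_value_bounds(1)[of _ A]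
  by (auto simp: sigma_max_def)

lemma sigma_max_pos: "A \<noteq> 0 \<Longrightarrow> 0 < sigma_max A"
  using ex_singular_value[of A] Max_ge[OF finite_singular_values, of _ A]
  by (force simp: sigma_max_def)

section \<open>The imbalance matrix and the operator \<open>T_op\<close>\<close>

text \<open>\<open>transp_app W x\<close> is the transpose of \<open>W\<close> applied to
  \<open>x\<close>, and \<open>trunc_app h W v\<close> is \<open>W\<close> applied to
  \<open>v\<close>; the two maps are adjoint by \<open>trunc_inner_transp_app\<close>.\<close>

definition transp_app :: "'r::finite hmat \<Rightarrow> real ^ 'r \<Rightarrow> nat \<Rightarrow> real" where
  "transp_app W x = (\<lambda>k. \<Sum>i\<in>UNIV. x $ i * W i k)"

definition trunc_app :: "nat \<Rightarrow> 'r::finite hmat \<Rightarrow> (nat \<Rightarrow> real) \<Rightarrow> real ^ 'r" where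
  "trunc_app h W v = (\<chi> i. trunc_inner h (W i) v)"

abbreviation sqnorm_transp_app :: "nat \<Rightarrow> 'r::finite hmat \<Rightarrow> real ^ 'r \<Rightarrow> real" where
  "sqnorm_transp_app h W x \<equiv> trunc_inner h (transp_app W x) (transp_app W x)"

text \<open>The entries of \<open>D(0)\<close> as a function of the indices, the form in which the
  eigenvalue estimates above take a matrix.\<close>

definition gram_diff :: "'n::finite hmat \<Rightarrow> 'm::finite hmat \<Rightarrow> nat \<Rightarrow> nat \<Rightarrow> real" where
  "gram_diff W1 W2 k l = (\<Sum>i\<in>UNIV. W1 i k * W1 i l) - (\<Sum>j\<in>UNIV. W2 j k * W2 j l)"

lemma imbalance_eq: "imbalance h W1 W2 = Matrix.mat h h (\<lambda>(k, l). gram_diff W1 W2 k l)"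
  by (simp add: imbalance_def gram_diff_def)

text \<open>Exchanging the roles of the two matrices turns each estimate for \<open>D(0)\<close>
  into one for \<open>-D(0)\<close>.\<close>

lemma uminus_imbalance: "- imbalance h W1 W2 = imbalance h W2 W1"
  by (intro eq_matI) (auto simp: imbalance_def)

lemma symm_on_gram_diff: "symm_on h (gram_diff W1 W2)"
  by (simp add: symm_on_def gram_diff_def mult.commute)

lemma trunc_inner_transp_app: "trunc_inner h (transp_app W x) v = inner x (trunc_app h W v)"
proof -
  have "trunc_inner h (transp_app W x) v = (\<Sum>k<h. \<Sum>i\<in>UNIV. x $ i * (W i k * v k))"
    by (simp add: trunc_inner_def transp_app_def sum_distrib_left sum_distrib_right mult_ac)
  also have "\<dots> = (\<Sum>i\<in>UNIV. \<Sum>k<h. x $ i * (W i k * v k))"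
    by (rule sum.swap)
  finally show ?thesis
    by (simp add: inner_vec_def trunc_app_def trunc_inner_def sum_distrib_left)
qed

lemma transp_app_sum: "transp_app W (\<Sum>j\<in>J. c j *\<^sub>R x j) = (\<lambda>k. \<Sum>j\<in>J. c j * transp_app W (x j) k)"
proof
  fix k
  have "transp_app W (\<Sum>j\<in>J. c j *\<^sub>R x j) k = (\<Sum>i\<in>UNIV. \<Sum>j\<in>J. c j * (x j $ i * W i k))"
    by (simp add: transp_app_def sum_distrib_left sum_distrib_right mult_ac)
  also have "\<dots> = (\<Sum>j\<in>J. \<Sum>i\<in>UNIV. c j * (x j $ i * W i k))"
    by (rule sum.swap)
  finally show "transp_app W (\<Sum>j\<in>J. c j *\<^sub>R x j) k = (\<Sum>j\<in>J. c j * transp_app W (x j) k)"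
    by (simp add: transp_app_def sum_distrib_left)
qed

lemma qform_gram_diff:
  "qform h (gram_diff W1 W2) v = (norm (trunc_app h W1 v))\<^sup>2 - (norm (trunc_app h W2 v))\<^sup>2"
proof -
  have *: "(\<Sum>l<h. (\<Sum>i\<in>UNIV. W i k * W i l) * v l) = transp_app W (trunc_app h W v) k"
    for W :: "'z::finite hmat" and k
  proof -
    have "(\<Sum>l<h. (\<Sum>i\<in>UNIV. W i k * W i l) * v l) = (\<Sum>l<h. \<Sum>i\<in>UNIV. W i l * v l * W i k)"
      by (simp add: sum_distrib_left sum_distrib_right mult_ac)
    also have "\<dots> = (\<Sum>i\<in>UNIV. \<Sum>l<h. W i l * v l * W i k)" by (rule sum.swap)
    finally show ?thesis by (simp add: transp_app_def trunc_app_def trunc_inner_def sum_distrib_right)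
  qed
  have "mat_app h (gram_diff W1 W2) v = (\<lambda>k. transp_app W1 (trunc_app h W1 v) k + (- 1) * transp_app W2 (trunc_app h W2 v) k)"
    unfolding mat_app_def gram_diff_def *[symmetric] by (simp add: algebra_simps sum_subtractf)
  then have "qform h (gram_diff W1 W2) v
      = trunc_inner h (transp_app W1 (trunc_app h W1 v)) v - trunc_inner h (transp_app W2 (trunc_app h W2 v)) v"
    unfolding qform_def by (simp only: trunc_inner_add_right trunc_inner_scale_right trunc_inner_commute[of h v "transp_app _ _"])
  then show ?thesis by (simp add: trunc_inner_transp_app dot_square_norm)
qed

lemma trunc_app_transp_app: "trunc_app h W2 (transp_app W1 x) = transpose (W_prod h W1 W2) *v x"
proof -
  have "trunc_inner h (W2 j) (transp_app W1 x) = (\<Sum>i\<in>UNIV. (\<Sum>k<h. W1 i k * W2 j k) * x $ i)" for j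
  proof -
    have "trunc_inner h (W2 j) (transp_app W1 x) = (\<Sum>k<h. \<Sum>i\<in>UNIV. W1 i k * W2 j k * x $ i)"
      by (simp add: trunc_inner_def transp_app_def sum_distrib_left mult_ac)
    also have "\<dots> = (\<Sum>i\<in>UNIV. \<Sum>k<h. W1 i k * W2 j k * x $ i)" by (rule sum.swap)
    finally show ?thesis by (simp add: sum_distrib_right)
  qed
  then show ?thesis
    by (simp only: trunc_app_def matrix_vector_mult_def transpose_def W_prod_def vec_lambda_beta)
qed

lemma W_prod_commute: "W_prod h W2 W1 = transpose (W_prod h W1 W2)"
  by (simp add: W_prod_def transpose_def mult.commute)

lemma norm_W_prod_commute: "norm (W_prod h W2 W1) = norm (W_prod h W1 W2)"
  by (simp add: W_prod_commute[of h W2] norm_transpose)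

text \<open>On the row space of \<open>W1\<close> the map \<open>W2\<close> acts through
  \<open>W(0)\<close> alone, hence weakly when \<open>W(0)\<close> is small.\<close>

lemma norm_trunc_app_transp_app_le: "norm (trunc_app h W2 (transp_app W1 x)) \<le> norm (W_prod h W1 W2) * norm x"
  using norm_matrix_vector_le[of "transpose (W_prod h W1 W2)" x] 
  by (simp only: trunc_app_transp_app norm_transpose)

lemma sqnorm_transp_app_le: "sqnorm_transp_app h W x \<le> norm x * norm (trunc_app h W (transp_app W x))"
  unfolding trunc_inner_transp_app by (rule norm_cauchy_schwarz)

lemma eig_max_ge:
  assumes "symm_on h a" "0 < h"
  shows "qform h a v \<le> eig_max (Matrix.mat h h (\<lambda>(k, l). a k l)) * trunc_inner h v v"
proof -
  obtain b e where be: "eigenbasis h a h b e" using ex_eigenbasis[OF assms(1)] by blast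
  then have "qform h a v \<le> e 0 * trunc_inner h v v" using assms(2) by (simp add: eigenbasis_def)
  then show ?thesis using eigenbasis_eig[OF be assms(2)] by simp
qed

lemma eig_max_le:
  assumes "symm_on h a" "0 < h" and le: "\<And>v. qform h a v \<le> c * trunc_inner h v v"
  shows "eig_max (Matrix.mat h h (\<lambda>(k, l). a k l)) \<le> c"
proof -
  obtain L where L: "orthonormal_family h 1 L"
    "\<And>d. eig_max (Matrix.mat h h (\<lambda>(k, l). a k l)) * trunc_inner h (lincomb 1 d L) (lincomb 1 d L)
          \<le> qform h a (lincomb 1 d L)"
    using eig_attained_on_subspace[of h a 1] assms(1,2) by auto
  have "trunc_inner h (lincomb 1 (\<lambda>_. 1) L) (lincomb 1 (\<lambda>_. 1) L) = 1"
    unfolding trunc_inner_lincomb_orthonormal[OF L(1)] by simp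
  then show ?thesis using L(2)[of "\<lambda>_. 1"] le[of "lincomb 1 (\<lambda>_. 1) L"] by simp
qed

text \<open>The larger root of \<open>t^2 = a t + b^2\<close>; both summands of
  \<open>alpha2\<close> have this form.\<close>

definition quad_root :: "real \<Rightarrow> real \<Rightarrow> real" where
  "quad_root a b = (a + sqrt (a\<^sup>2 + 4 * b\<^sup>2)) / 2"

text \<open>Completing the square. The factor \<open>y\<close>, a squared norm in the application,
  avoids normalising vectors.\<close>

lemma le_quad_root:
  assumes "t\<^sup>2 \<le> a * y * t + b\<^sup>2 * y\<^sup>2" "0 \<le> y"
  shows "t \<le> quad_root a b * y"
proof -
  have "(2 * t - a * y)\<^sup>2 \<le> (a\<^sup>2 + 4 * b\<^sup>2) * y\<^sup>2"
    using assms(1) by (simp add: power2_eq_square algebra_simps)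
  then have "2 * t - a * y \<le> sqrt ((a\<^sup>2 + 4 * b\<^sup>2) * y\<^sup>2)"
    by (rule real_le_rsqrt)
  also have "\<dots> = sqrt (a\<^sup>2 + 4 * b\<^sup>2) * y"
    using assms(2) by (simp add: real_sqrt_mult)
  finally show ?thesis by (simp add: quad_root_def algebra_simps)
qed

lemma lam_minus_eq: "lam_minus h W1 W2 = lam_plus h W2 W1"
  by (simp add: lam_minus_def lam_plus_def uminus_imbalance)

text \<open>Let \<open>v\<close> be the transpose of \<open>W1\<close> applied to \<open>x\<close>,
  and \<open>t = |v|^2\<close>. Then \<open>t^2 \<le> |x|^2 |W1 v|^2\<close>, where
  \<open>|W1 v|^2\<close> is the form of \<open>D(0)\<close> at \<open>v\<close> plus
  \<open>|W2 v|^2\<close>. The first is at most \<open>lam_plus * t\<close>, the second at most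
  \<open>|W(0)|^2 |x|^2\<close>, which gives a quadratic inequality for \<open>t\<close>.\<close>

lemma sqnorm_transp_app_le_quad_root:
  assumes "0 < h"
  shows "sqnorm_transp_app h W1 x \<le> quad_root (lam_plus h W1 W2) (norm (W_prod h W1 W2)) * (norm x)\<^sup>2"
proof (rule le_quad_root)
  define v where "v = transp_app W1 x"
  define t where "t = trunc_inner h v v"
  have "t \<le> norm x * norm (trunc_app h W1 v)"
    using sqnorm_transp_app_le[of h W1 x] by (simp add: t_def v_def)
  then have "t\<^sup>2 \<le> (norm x * norm (trunc_app h W1 v))\<^sup>2"
    unfolding t_def by (intro power_mono trunc_inner_nonneg)
  also have "\<dots> = (norm x)\<^sup>2 * (qform h (gram_diff W1 W2) v + (norm (trunc_app h W2 v))\<^sup>2)"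
    by (simp add: qform_gram_diff power_mult_distrib)
  also have "\<dots> \<le> (norm x)\<^sup>2 * (lam_plus h W1 W2 * t + (norm (W_prod h W1 W2) * norm x)\<^sup>2)"
  proof (intro mult_left_mono add_mono)
    have "qform h (gram_diff W1 W2) v \<le> eig_max (imbalance h W1 W2) * t"
      unfolding imbalance_eq t_def by (rule eig_max_ge[OF symm_on_gram_diff assms])
    also have "\<dots> \<le> lam_plus h W1 W2 * t"
      unfolding t_def by (intro mult_right_mono trunc_inner_nonneg) (simp add: lam_plus_def)
    finally show "qform h (gram_diff W1 W2) v \<le> lam_plus h W1 W2 * t" .
    show "(norm (trunc_app h W2 v))\<^sup>2 \<le> (norm (W_prod h W1 W2) * norm x)\<^sup>2"
      unfolding v_def by (intro power_mono norm_trunc_app_transp_app_le) simp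
  qed simp
  finally show "(sqnorm_transp_app h W1 x)\<^sup>2 \<le> lam_plus h W1 W2 * (norm x)\<^sup>2 * sqnorm_transp_app h W1 x
      + (norm (W_prod h W1 W2))\<^sup>2 * ((norm x)\<^sup>2)\<^sup>2"
    unfolding t_def v_def by (simp add: power_mult_distrib power2_eq_square algebra_simps)
qed simp

lemma ex_index_bij: "\<exists>g. bij_betw g {..<CARD('n)} (UNIV :: 'n::finite set)"
  using ex_bij_betw_nat_finite[of "UNIV :: 'n set"] by (simp add: atLeast0LessThan)

text \<open>If the \<open>n\<close>-th eigenvalue \<open>lam\<close> is positive, then
  \<open>|W1 v|^2 \<ge> lam |v|^2\<close> on an \<open>n\<close>-dimensional space, so
  \<open>W1\<close> maps that space onto all of the \<open>n\<close>-dimensional target. Writing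
  \<open>x = W1 v\<close> and applying Cauchy-Schwarz to \<open>|x|^2\<close>, the pairing of
  \<open>v\<close> with the transposed image of \<open>x\<close>, gives the bound.\<close>

lemma eig_le_sqnorm_transp_app:
  fixes W1 :: "'n::finite hmat"
  assumes h: "CARD('n) \<le> h"
  shows "max (eig CARD('n) (imbalance h W1 W2)) 0 * (norm x)\<^sup>2 \<le> sqnorm_transp_app h W1 x"
proof (cases "eig CARD('n) (imbalance h W1 W2) > 0")
  case False
  then show ?thesis by (simp add: max_def trunc_inner_nonneg)
next
  case True
  define lam where "lam = eig CARD('n) (imbalance h W1 W2)"
  define n where "n = CARD('n)"
  have lam: "lam > 0" using True by (simp add: lam_def)
  obtain L where L: "orthonormal_family h n L"
    "\<And>c. lam * trunc_inner h (lincomb n c L) (lincomb n c L) \<le> qform h (gram_diff W1 W2) (lincomb n c L)"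
    using eig_attained_on_subspace[OF symm_on_gram_diff, of n h W1 W2] h
    by (auto simp: lam_def n_def imbalance_eq)
  obtain g where g: "bij_betw g {..<n} (UNIV :: 'n set)"
    using ex_index_bij unfolding n_def by blast
  \<comment> \<open>An isometry from \<open>real ^ 'n\<close> onto the span of the
    \<open>L j\<close>; it makes the source and target of \<open>F\<close> the same type, so that
    injectivity gives surjectivity.\<close>
  define emb where "emb c = lincomb n (\<lambda>j. c $ g j) L" for c :: "real ^ 'n"
  have emb_lin: "emb (c + d) = (\<lambda>k. emb c k + emb d k)" "emb (r *\<^sub>R c) = (\<lambda>k. r * emb c k)" for c d r
    by (simp_all add: emb_def lincomb_def algebra_simps sum.distrib sum_distrib_left)
  have emb_norm: "trunc_inner h (emb c) (emb c) = (norm c)\<^sup>2" for c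
    unfolding emb_def trunc_inner_lincomb_orthonormal[OF L(1)] norm_vec_squared
    using sum.reindex_bij_betw[OF g, of "\<lambda>i. (c $ i)\<^sup>2"] by simp
  have emb_ge: "lam * (norm c)\<^sup>2 \<le> (norm (trunc_app h W1 (emb c)))\<^sup>2" for c
  proof -
    have "lam * (norm c)\<^sup>2 \<le> qform h (gram_diff W1 W2) (emb c)"
      using L(2)[of "\<lambda>j. c $ g j"] unfolding emb_norm[symmetric] emb_def .
    then show ?thesis unfolding qform_gram_diff by (smt (verit) zero_le_power2)
  qed
  define F where "F c = trunc_app h W1 (emb c)" for c
  have "linear F"
    by (rule linearI) (simp_all add: F_def trunc_app_def emb_lin trunc_inner_add_right trunc_inner_scale_right
        Finite_Cartesian_Product.vec_eq_iff)
  moreover have "inj F"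
  proof (subst linear_injective_0[OF \<open>linear F\<close>], intro allI impI)
    fix c assume "F c = 0"
    then have "lam * (norm c)\<^sup>2 \<le> 0" using emb_ge[of c] by (simp add: F_def)
    then show "c = 0" using lam by (smt (verit) zero_less_mult_iff zero_less_norm_iff zero_less_power2)
  qed
  ultimately have "surj F" by (intro linear_injective_imp_surjective refl)
  then obtain c where c: "F c = x" by (metis surjD)
  define q where "q = sqnorm_transp_app h W1 x"
  have q: "q \<ge> 0" by (simp add: q_def trunc_inner_nonneg)
  have "(norm x)\<^sup>2 = trunc_inner h (transp_app W1 x) (emb c)"
    unfolding trunc_inner_transp_app using c by (simp add: F_def dot_square_norm)
  then have "((norm x)\<^sup>2)\<^sup>2 \<le> q * (norm c)\<^sup>2"
    using trunc_inner_Cauchy_Schwarz[of h "transp_app W1 x" "emb c"] by (simp add: q_def emb_norm)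
  then have "lam * ((norm x)\<^sup>2)\<^sup>2 \<le> q * (lam * (norm c)\<^sup>2)"
    using lam by simp
  also have "\<dots> \<le> q * (norm x)\<^sup>2"
    using emb_ge[of c] c q by (intro mult_left_mono) (auto simp: F_def)
  finally have "lam * (norm x)\<^sup>2 * (norm x)\<^sup>2 \<le> q * (norm x)\<^sup>2"
    by (simp add: power2_eq_square mult_ac)
  then have "lam * (norm x)\<^sup>2 \<le> q"
    using q by (cases "x = 0") (auto simp: mult_le_cancel_right)
  then show ?thesis using lam by (simp add: q_def lam_def max_def)
qed

text \<open>The test space for \<open>eig_geI\<close> is the row space of \<open>W1\<close>: there
  \<open>W1\<close> stretches by nearly \<open>s\<close> in the squared norm, while
  \<open>W2\<close> contributes only through the small product \<open>W(0)\<close>.\<close>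

lemma eig_imbalance_ge:
  fixes W1 :: "'n::finite hmat" and W2 :: "'m::finite hmat"
  assumes h: "CARD('n) \<le> h" and \<epsilon>: "0 \<le> \<epsilon>" "2 * \<epsilon> < s"
    and W1: "\<And>x. (s - \<epsilon>) * (norm x)\<^sup>2 \<le> sqnorm_transp_app h W1 x"
    and W: "norm (W_prod h W1 W2) \<le> \<epsilon>"
  shows "s - 3 * \<epsilon> \<le> eig CARD('n) (imbalance h W1 W2)"
proof -
  define n where "n = CARD('n)"
  obtain g where g: "bij_betw g {..<n} (UNIV :: 'n set)"
    using ex_index_bij unfolding n_def by blast
  define L where "L j = transp_app W1 (axis (g j) 1)" for j
  show ?thesis
    unfolding imbalance_eq
  proof (rule eig_geI[OF symm_on_gram_diff _ h, where L = L])
    fix c :: "nat \<Rightarrow> real" assume c: "\<exists>j<CARD('n). c j \<noteq> 0"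
    define x where "x = (\<Sum>j<n. c j *\<^sub>R axis (g j) 1 :: real ^ 'n)"
    have Lx: "lincomb CARD('n) c L = transp_app W1 x"
      unfolding lincomb_def L_def x_def n_def[symmetric] transp_app_sum ..
    have "x \<noteq> 0"
    proof -
      obtain j where j: "j < n" "c j \<noteq> 0" using c by (auto simp: n_def)
      have "x $ g j = (\<Sum>i<n. if i = j then c i else 0)"
      proof -
        have "g j = g i \<longleftrightarrow> i = j" if "i < n" for i
          using g j(1) that by (auto simp: bij_betw_def inj_on_def)
        then have "x $ g j = (\<Sum>i<n. c i * (if i = j then 1 else 0))"
          unfolding x_def by (simp add: axis_def)
        then show ?thesis by (simp only: mult_1_right mult_zero_right if_distrib cong: if_cong)
      qed
      then have "x $ g j = c j" using j by simp
      then show ?thesis using j by auto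
    qed
    then have xpos: "(norm x)\<^sup>2 > 0" by simp
    define t where "t = sqnorm_transp_app h W1 x"
    have t: "(s - \<epsilon>) * (norm x)\<^sup>2 \<le> t" using W1 by (simp add: t_def)
    have tpos: "t > 0" using t xpos \<epsilon> by (smt (verit) mult_pos_pos)
    have 1: "t\<^sup>2 \<le> (norm x)\<^sup>2 * (norm (trunc_app h W1 (transp_app W1 x)))\<^sup>2"
      unfolding power_mult_distrib[symmetric]
      using sqnorm_transp_app_le[of h W1 x] tpos by (intro power_mono) (auto simp: t_def)
    have "norm (trunc_app h W2 (transp_app W1 x)) \<le> \<epsilon> * norm x"
      using norm_trunc_app_transp_app_le[of h W2 W1 x] W by (meson mult_right_mono norm_ge_zero order_trans)
    then have 2: "(norm (trunc_app h W2 (transp_app W1 x)))\<^sup>2 \<le> \<epsilon>\<^sup>2 * (norm x)\<^sup>2"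
      unfolding power_mult_distrib[symmetric] by (intro power_mono) auto
    \<comment> \<open>One \<open>\<epsilon>\<close> is lost in
      \<open>(s - \<epsilon>) * y \<le> t\<close>; the other two absorb the \<open>W2\<close> term,
      as \<open>2 * \<epsilon> < s\<close> gives
      \<open>\<epsilon> \<le> 2 * (s - \<epsilon>)\<close>.\<close>
    have "(s - 3 * \<epsilon>) * t * (norm x)\<^sup>2 \<le> t\<^sup>2 - \<epsilon>\<^sup>2 * (norm x)\<^sup>2 * (norm x)\<^sup>2"
    proof -
      define y where "y = (norm x)\<^sup>2"
      have y: "y > 0" "(s - \<epsilon>) * y \<le> t" using xpos t by (auto simp: y_def)
      have "\<epsilon>\<^sup>2 * y * y \<le> (2 * \<epsilon> * y) * ((s - \<epsilon>) * y)"
      proof -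
        have "\<epsilon> * \<epsilon> \<le> 2 * \<epsilon> * (s - \<epsilon>)" using \<epsilon> mult_left_mono[of \<epsilon> "2 * (s - \<epsilon>)" \<epsilon>] by (simp add: algebra_simps)
        then have "\<epsilon> * \<epsilon> * (y * y) \<le> 2 * \<epsilon> * (s - \<epsilon>) * (y * y)"
          using y by (intro mult_right_mono) auto
        then show ?thesis by (simp add: power2_eq_square mult_ac)
      qed
      also have "\<dots> \<le> (2 * \<epsilon> * y) * t" using \<epsilon> y by (intro mult_left_mono) auto
      finally have a: "\<epsilon>\<^sup>2 * y * y \<le> 2 * \<epsilon> * y * t" .
      have "(s - \<epsilon>) * y * t \<le> t * t" using y tpos by (intro mult_right_mono) auto
      with a show ?thesis unfolding y_def[symmetric] by (simp add: power2_eq_square algebra_simps)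
    qed
    also have "\<dots> \<le> qform h (gram_diff W1 W2) (transp_app W1 x) * (norm x)\<^sup>2"
      unfolding qform_gram_diff using 1 mult_right_mono[OF 2, of "(norm x)\<^sup>2"]
      by (simp add: algebra_simps)
    finally have "(s - 3 * \<epsilon>) * t \<le> qform h (gram_diff W1 W2) (transp_app W1 x)"
      using xpos by (simp add: mult_le_cancel_right)
    then show "0 < trunc_inner h (lincomb CARD('n) c L) (lincomb CARD('n) c L) \<and>
       (s - 3 * \<epsilon>) * trunc_inner h (lincomb CARD('n) c L) (lincomb CARD('n) c L)
       \<le> qform h (gram_diff W1 W2) (lincomb CARD('n) c L)"
      unfolding Lx using tpos by (simp add: t_def)
  qed simp
qed

text \<open>The form of \<open>D(0)\<close> is at most \<open>|W1 v|^2\<close>, and the bound for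
  the transpose of \<open>W1\<close> passes to \<open>W1\<close> by duality: Cauchy-Schwarz with
  \<open>y = W1 v\<close>.\<close>

lemma eig_max_imbalance_le:
  fixes W1 :: "'n::finite hmat" and W2 :: "'m::finite hmat"
  assumes h: "0 < h" and r: "0 \<le> r" and W1: "\<And>x. sqnorm_transp_app h W1 x \<le> r * (norm x)\<^sup>2"
  shows "eig_max (imbalance h W1 W2) \<le> r"
  unfolding imbalance_eq
proof (rule eig_max_le[OF symm_on_gram_diff h])
  fix v
  define y where "y = trunc_app h W1 v"
  have "((norm y)\<^sup>2)\<^sup>2 = (trunc_inner h (transp_app W1 y) v)\<^sup>2"
    by (simp add: trunc_inner_transp_app y_def dot_square_norm)
  also have "\<dots> \<le> sqnorm_transp_app h W1 y * trunc_inner h v v" by (rule trunc_inner_Cauchy_Schwarz)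
  also have "\<dots> \<le> r * (norm y)\<^sup>2 * trunc_inner h v v"
    by (intro mult_right_mono W1 trunc_inner_nonneg)
  finally have "(norm y)\<^sup>2 * (norm y)\<^sup>2 \<le> (r * trunc_inner h v v) * (norm y)\<^sup>2"
    by (simp add: power2_eq_square mult_ac)
  then have "(norm y)\<^sup>2 \<le> r * trunc_inner h v v"
    using mult_nonneg_nonneg[OF r trunc_inner_nonneg[of h v]] mult_right_le_imp_le[of "(norm y)\<^sup>2" "(norm y)\<^sup>2"]
    by (cases "y = 0") (simp, meson zero_less_norm_iff zero_less_power)
  then show "qform h (gram_diff W1 W2) v \<le> r * trunc_inner h v v"
    unfolding qform_gram_diff y_def by (smt (verit) zero_le_power2)
qed

section \<open>Extreme eigenvalues of \<open>T_op\<close> composed with its adjoint\<close>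

lemma sum_UNIV_Plus:
  "(\<Sum>r\<in>(UNIV :: ('n::finite + 'm::finite) set). f r) = (\<Sum>i\<in>UNIV. f (Inl i)) + (\<Sum>j\<in>UNIV. f (Inr j))"
  using sum.Plus[of "UNIV :: 'n set" "UNIV :: 'm set" f] by (simp add: UNIV_Plus_UNIV)

lemma T_op_eq:
  "T_op W1 W2 U (Inl i) = transp_app W2 (U $ i)" "T_op W1 W2 U (Inr j) = transp_app W1 (transpose U $ j)"
  by (simp_all add: T_op_def transp_app_def transpose_def)

lemma frob_inner_eq: "frob_inner h A B = (\<Sum>r\<in>UNIV. trunc_inner h (A r) (B r))"
  by (simp add: frob_inner_def trunc_inner_def)

text \<open>Rows of \<open>U\<close> meet \<open>W2\<close> and columns meet \<open>W1\<close>, so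
  bounds on the operator reduce to bounds for single vectors.\<close>

lemma frob_inner_T_op:
  "frob_inner h (T_op W1 W2 U) (T_op W1 W2 U) =
    (\<Sum>i\<in>UNIV. sqnorm_transp_app h W2 (U $ i)) + (\<Sum>j\<in>UNIV. sqnorm_transp_app h W1 (transpose U $ j))"
  by (simp add: frob_inner_eq sum_UNIV_Plus T_op_eq)

text \<open>Since \<open>hadjoint\<close> is a choice, its defining property holds once some adjoint
  is exhibited.\<close>

lemma hadjoint_T_op: "inner U (hadjoint h (T_op W1 W2) V) = frob_inner h (T_op W1 W2 U) V"
proof -
  \<comment> \<open>For stacked blocks \<open>V1\<close>, \<open>V2\<close> this is
    \<open>V1\<close> times the transpose of \<open>W2\<close> plus \<open>W1\<close> times the
    transpose of \<open>V2\<close>.\<close>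
  define T' where "T' V = (\<chi> i j. trunc_inner h (V (Inl i)) (W2 j) + trunc_inner h (V (Inr j)) (W1 i))" for V
  have "inner U (T' V) = frob_inner h (T_op W1 W2 U) V" for U V
  proof -
    have "inner U (T' V) = (\<Sum>i\<in>UNIV. \<Sum>j\<in>UNIV. U $ i $ j * trunc_inner h (V (Inl i)) (W2 j))
        + (\<Sum>i\<in>UNIV. \<Sum>j\<in>UNIV. U $ i $ j * trunc_inner h (V (Inr j)) (W1 i))"
      by (simp add: inner_vec_def T'_def algebra_simps sum.distrib)
    also have "(\<Sum>i\<in>UNIV. \<Sum>j\<in>UNIV. U $ i $ j * trunc_inner h (V (Inr j)) (W1 i))
        = (\<Sum>j\<in>UNIV. \<Sum>i\<in>UNIV. U $ i $ j * trunc_inner h (V (Inr j)) (W1 i))"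
      by (rule sum.swap)
    finally show ?thesis
      unfolding frob_inner_eq sum_UNIV_Plus T_op_eq trunc_inner_transp_app inner_vec_def
      by (simp add: trunc_app_def transpose_def trunc_inner_commute[of h "W1 _"] trunc_inner_commute[of h "W2 _"])
  qed
  then have "\<exists>T'. \<forall>U V. inner U (T' V) = frob_inner h (T_op W1 W2 U) V" by blast
  from someI_ex[OF this] show ?thesis unfolding hadjoint_def by blast
qed

text \<open>Linearity of the chosen adjoint is read off from its defining identity by pairing with
  arbitrary matrices.\<close>

lemma selfadjoint_T_op:
  fixes W1 :: "'n::finite hmat" and W2 :: "'m::finite hmat"
  shows "selfadjoint (hadjoint h (T_op W1 W2) \<circ> T_op W1 W2)"
proof -
  have add: "frob_inner h A (T_op W1 W2 (U + V)) = frob_inner h A (T_op W1 W2 U) + frob_inner h A (T_op W1 W2 V)"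
    for A U V
  proof -
    have "T_op W1 W2 (U + V) r = (\<lambda>k. T_op W1 W2 U r k + T_op W1 W2 V r k)" for r
      by (cases r) (simp_all add: T_op_def algebra_simps sum.distrib)
    then show ?thesis by (simp add: frob_inner_eq trunc_inner_add_right sum.distrib)
  qed
  have scale: "frob_inner h A (T_op W1 W2 (c *\<^sub>R U)) = c * frob_inner h A (T_op W1 W2 U)" for A c U
  proof -
    have "T_op W1 W2 (c *\<^sub>R U) r = (\<lambda>k. c * T_op W1 W2 U r k)" for r
      by (cases r) (simp_all add: T_op_def algebra_simps sum_distrib_left)
    then show ?thesis by (simp add: frob_inner_eq trunc_inner_scale_right sum_distrib_left)
  qed
  have comm: "frob_inner h A B = frob_inner h B A" for A B :: "('n + 'm) hmat"
    by (simp add: frob_inner_def mult.commute)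
  show ?thesis
    unfolding selfadjoint_def
  proof (intro conjI allI linearI)
    show "(hadjoint h (T_op W1 W2) \<circ> T_op W1 W2) (U + V)
        = (hadjoint h (T_op W1 W2) \<circ> T_op W1 W2) U + (hadjoint h (T_op W1 W2) \<circ> T_op W1 W2) V" for U V
      by (subst vector_eq_ldot[symmetric]) (simp add: inner_add_right hadjoint_T_op add)
    show "(hadjoint h (T_op W1 W2) \<circ> T_op W1 W2) (c *\<^sub>R U)
        = c *\<^sub>R (hadjoint h (T_op W1 W2) \<circ> T_op W1 W2) U" for c U
      by (subst vector_eq_ldot[symmetric]) (simp add: hadjoint_T_op scale)
    show "inner U ((hadjoint h (T_op W1 W2) \<circ> T_op W1 W2) V)
        = inner ((hadjoint h (T_op W1 W2) \<circ> T_op W1 W2) U) V" for U V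
      by (simp add: hadjoint_T_op inner_commute[of _ V] comm[of "T_op W1 W2 V"])
  qed
qed

definition T_max :: "nat \<Rightarrow> 'n::finite hmat \<Rightarrow> 'm::finite hmat \<Rightarrow> real" where
  "T_max h W1 W2 = Max (operator_eigenvalues (hadjoint h (T_op W1 W2) \<circ> T_op W1 W2))"

definition T_min :: "nat \<Rightarrow> 'n::finite hmat \<Rightarrow> 'm::finite hmat \<Rightarrow> real" where
  "T_min h W1 W2 = Min (operator_eigenvalues (hadjoint h (T_op W1 W2) \<circ> T_op W1 W2))"

lemma T_max_le_iff:
  "T_max h W1 W2 \<le> c \<longleftrightarrow> (\<forall>U. frob_inner h (T_op W1 W2 U) (T_op W1 W2 U) \<le> c * (norm U)\<^sup>2)"
  by (simp add: T_max_def Max_operator_eigenvalues_le_iff[OF selfadjoint_T_op] hadjoint_T_op)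

lemma T_min_ge_iff:
  "c \<le> T_min h W1 W2 \<longleftrightarrow> (\<forall>U. c * (norm U)\<^sup>2 \<le> frob_inner h (T_op W1 W2 U) (T_op W1 W2 U))"
  by (simp add: T_min_def Min_operator_eigenvalues_ge_iff[OF selfadjoint_T_op] hadjoint_T_op)

lemma T_min_le_T_max: "T_min h W1 W2 \<le> T_max h W1 W2"
  unfolding T_min_def T_max_def
  using finite_operator_eigenvalues[OF selfadjoint_T_op] operator_eigenvalues_nonempty[OF selfadjoint_T_op]
  by (meson Max_ge Min_in)

lemma norm_transpose_rows: "(\<Sum>j\<in>UNIV. (norm (transpose U $ j))\<^sup>2) = (norm (U :: real ^ 'm::finite ^ 'n::finite))\<^sup>2"
  unfolding norm_vec_squared[symmetric] norm_transpose ..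

lemma T_max_le:
  fixes W1 :: "'n::finite hmat" and W2 :: "'m::finite hmat"
  assumes "\<And>x. sqnorm_transp_app h W1 x \<le> a * (norm x)\<^sup>2" "\<And>x. sqnorm_transp_app h W2 x \<le> b * (norm x)\<^sup>2"
  shows "T_max h W1 W2 \<le> a + b"
  unfolding T_max_le_iff frob_inner_T_op
proof
  fix U :: "real ^ 'm ^ 'n"
  have "(\<Sum>i\<in>UNIV. sqnorm_transp_app h W2 (U $ i)) \<le> b * (norm U)\<^sup>2"
    unfolding norm_vec_squared[of U] sum_distrib_left by (intro sum_mono assms)
  moreover have "(\<Sum>j\<in>UNIV. sqnorm_transp_app h W1 (transpose U $ j)) \<le> a * (norm U)\<^sup>2"
    unfolding norm_transpose_rows[of U, symmetric] sum_distrib_left by (intro sum_mono assms)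
  ultimately show "(\<Sum>i\<in>UNIV. sqnorm_transp_app h W2 (U $ i)) + (\<Sum>j\<in>UNIV. sqnorm_transp_app h W1 (transpose U $ j))
      \<le> (a + b) * (norm U)\<^sup>2" by (simp add: algebra_simps)
qed

lemma T_min_ge:
  fixes W1 :: "'n::finite hmat" and W2 :: "'m::finite hmat"
  assumes "\<And>x. a * (norm x)\<^sup>2 \<le> sqnorm_transp_app h W1 x" "\<And>x. b * (norm x)\<^sup>2 \<le> sqnorm_transp_app h W2 x"
  shows "a + b \<le> T_min h W1 W2"
  unfolding T_min_ge_iff frob_inner_T_op
proof
  fix U :: "real ^ 'm ^ 'n"
  have "b * (norm U)\<^sup>2 \<le> (\<Sum>i\<in>UNIV. sqnorm_transp_app h W2 (U $ i))"
    unfolding norm_vec_squared[of U] sum_distrib_left by (intro sum_mono assms)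
  moreover have "a * (norm U)\<^sup>2 \<le> (\<Sum>j\<in>UNIV. sqnorm_transp_app h W1 (transpose U $ j))"
    unfolding norm_transpose_rows[of U, symmetric] sum_distrib_left by (intro sum_mono assms)
  ultimately show "(a + b) * (norm U)\<^sup>2
      \<le> (\<Sum>i\<in>UNIV. sqnorm_transp_app h W2 (U $ i)) + (\<Sum>j\<in>UNIV. sqnorm_transp_app h W1 (transpose U $ j))"
    by (simp add: algebra_simps)
qed

lemma sigma_T_eq: "sigma_max_T h W1 W2 = sqrt (T_max h W1 W2)" "sigma_min_T h W1 W2 = sqrt (T_min h W1 W2)"
  by (simp_all add: sigma_max_T_def sigma_min_T_def T_max_def T_min_def)

section \<open>The deterministic estimate\<close>

lemma sqrt_ge_self: "z \<le> sqrt (z\<^sup>2 + 4 * b\<^sup>2)" for z b :: real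
  by (rule real_le_rsqrt) simp

text \<open>The correction is written with \<open>d\<close> in place of \<open>z\<close> so that the
  two square roots in \<alpha>1 receive the same one.\<close>

lemma sqrt_le_add_quotient:
  fixes z b d :: real
  assumes "0 < d" "d \<le> z"
  shows "sqrt (z\<^sup>2 + 4 * b\<^sup>2) \<le> z + 2 * b\<^sup>2 / d"
proof (rule real_le_lsqrt)
  show "0 \<le> z + 2 * b\<^sup>2 / d" using assms by simp
  have "4 * b\<^sup>2 \<le> 4 * b\<^sup>2 * (z / d)"
    using assms mult_left_mono[of 1 "z / d" "4 * b\<^sup>2"] by simp
  moreover have "(z + 2 * b\<^sup>2 / d)\<^sup>2 = z\<^sup>2 + 4 * b\<^sup>2 * (z / d) + (2 * b\<^sup>2 / d)\<^sup>2"
    by (simp add: power2_eq_square algebra_simps)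
  ultimately show "z\<^sup>2 + 4 * b\<^sup>2 \<le> (z + 2 * b\<^sup>2 / d)\<^sup>2"
    by (smt (verit) zero_le_power2)
qed

lemma quad_root_le: "0 \<le> a \<Longrightarrow> 0 \<le> b \<Longrightarrow> quad_root a b \<le> a + b"
proof -
  assume "0 \<le> a" "0 \<le> b"
  then have "sqrt (a\<^sup>2 + 4 * b\<^sup>2) \<le> a + 2 * b"
    by (intro real_le_lsqrt) (simp_all add: power2_eq_square algebra_simps)
  then show ?thesis by (simp add: quad_root_def)
qed

lemma quad_root_ge: "0 \<le> a \<Longrightarrow> a \<le> quad_root a b"
  using sqrt_ge_self[of a b] by (simp add: quad_root_def)

lemma quad_root_mono: "0 \<le> b \<Longrightarrow> b \<le> c \<Longrightarrow> quad_root a b \<le> quad_root a c"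
  by (simp add: quad_root_def power_mono)

text \<open>The difference of the two square roots \<open>X\<close> and \<open>Y\<close> is the
  difference of their squares over \<open>X + Y\<close>, and
  \<open>X + Y \<le> 8 * s\<close>.\<close>

lemma quad_root_diff:
  assumes "0 < s" "0 \<le> w" "w \<le> b" "b \<le> s" "0 \<le> a" "a \<le> 2 * s"
  shows "quad_root a w + (b\<^sup>2 - w\<^sup>2) / (4 * s) \<le> quad_root a b"
proof -
  define X where "X = sqrt (a\<^sup>2 + 4 * b\<^sup>2)"
  define Y where "Y = sqrt (a\<^sup>2 + 4 * w\<^sup>2)"
  have YX: "Y \<le> X" using assms by (simp add: X_def Y_def power_mono)
  have "X \<le> a + 2 * b"
    unfolding X_def using assms by (intro real_le_lsqrt) (simp_all add: power2_eq_square algebra_simps)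
  then have "X + Y \<le> 8 * s" using YX assms by linarith
  then have "(X - Y) * (X + Y) \<le> (X - Y) * (8 * s)"
    using YX by (intro mult_left_mono) auto
  moreover have "(X - Y) * (X + Y) = X\<^sup>2 - Y\<^sup>2"
    by (simp add: power2_eq_square algebra_simps)
  moreover have "X\<^sup>2 - Y\<^sup>2 = 4 * (b\<^sup>2 - w\<^sup>2)" by (simp add: X_def Y_def)
  ultimately have "4 * (b\<^sup>2 - w\<^sup>2) \<le> (X - Y) * (8 * s)" by simp
  then have "(b\<^sup>2 - w\<^sup>2) / (4 * s) \<le> (X - Y) / 2"
    using assms(1) by (simp add: field_simps)
  moreover have "quad_root a b = (a + X) / 2" "quad_root a w = (a + Y) / 2"
    by (simp_all add: quad_root_def X_def Y_def)
  ultimately show ?thesis by (simp only: add_divide_distrib diff_divide_distrib)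
qed

text \<open>Pure real arithmetic. In the application \<open>p\<close> and \<open>q\<close> are the
  positive parts of the \<open>n\<close>-th eigenvalue of \<open>D(0)\<close> and the
  \<open>m\<close>-th of \<open>-D(0)\<close>, \<open>a\<close> and \<open>b\<close> are
  \<open>lam_plus\<close> and \<open>lam_minus\<close>, \<open>w\<close> is the norm of
  \<open>W(0)\<close>, and \<open>B\<close> is a constant bounding \<open>beta2\<close>.\<close>

lemma alpha_ratio_bounds:
  fixes s \<epsilon> a b p q w \<beta>1 \<beta>2 B :: real
  assumes s: "0 < s" and \<epsilon>: "0 \<le> \<epsilon>" "6 * \<epsilon> \<le> s"
    and p: "s - 3 * \<epsilon> \<le> p" "p \<le> a" "a \<le> s + \<epsilon>"
    and q: "s - 3 * \<epsilon> \<le> q" "q \<le> b" "b \<le> s + \<epsilon>"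
    and w: "0 \<le> w" "w \<le> \<epsilon>"
    and \<beta>: "0 \<le> \<beta>1" "\<beta>1 \<le> w" "w \<le> \<beta>2" "\<beta>2 \<le> B" "B \<le> s"
    and \<beta>1: "\<beta>1 = 0 \<or> 4 * w \<le> \<beta>2"
  defines "\<alpha>1 \<equiv> (- (a - p) - (b - q) + sqrt ((a - p + (p + q))\<^sup>2 + 4 * \<beta>1\<^sup>2)
      + sqrt ((b - q + (p + q))\<^sup>2 + 4 * \<beta>1\<^sup>2)) / 2"
    and "\<alpha>2 \<equiv> quad_root a \<beta>2 + quad_root b \<beta>2"
  shows "\<alpha>1 * (quad_root a w + quad_root b w) \<le> (p + q) * \<alpha>2" and "0 < \<alpha>2"
    and "1 - (8 * \<epsilon> + 2 * B) / s \<le> \<alpha>1 / \<alpha>2"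
proof -
  define D where "D = p + q"
  define F where "F = quad_root a w + quad_root b w"
  have D: "s \<le> D" using \<epsilon> p q by (simp add: D_def)
  have a0: "0 \<le> a" "0 \<le> b" using \<epsilon> p q s by linarith+
  \<comment> \<open>Each root is at most \<open>s + 2 * \<epsilon>\<close>, and
    \<open>4 * \<epsilon> \<le> s\<close>.\<close>
  have F: "0 \<le> F" "F \<le> 3 * s"
    using quad_root_le[OF a0(1) w(1)] quad_root_le[OF a0(2) w(1)]
      quad_root_ge[OF a0(1), of w] quad_root_ge[OF a0(2), of w] a0 p q w \<epsilon>
    unfolding F_def by linarith+
  have \<alpha>1_ge: "D \<le> \<alpha>1"
    using sqrt_ge_self[of "a - p + (p + q)" \<beta>1] sqrt_ge_self[of "b - q + (p + q)" \<beta>1]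
    unfolding \<alpha>1_def D_def by simp
  have \<alpha>1_le: "\<alpha>1 \<le> D + 2 * \<beta>1\<^sup>2 / D"
    using sqrt_le_add_quotient[of D "a - p + D" \<beta>1] sqrt_le_add_quotient[of D "b - q + D" \<beta>1] D s p q
    unfolding \<alpha>1_def D_def[symmetric] by (simp add: field_simps D_def)
  have \<alpha>2_ge: "a + b \<le> \<alpha>2"
    using quad_root_ge[OF a0(1), of \<beta>2] quad_root_ge[OF a0(2), of \<beta>2] by (simp add: \<alpha>2_def)
  then show \<alpha>2_pos: "0 < \<alpha>2" using p q D s unfolding D_def by linarith
  have F\<alpha>2: "F \<le> \<alpha>2"
    unfolding F_def \<alpha>2_def by (intro add_mono quad_root_mono w \<beta>)
  show "\<alpha>1 * (quad_root a w + quad_root b w) \<le> (p + q) * \<alpha>2"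
    unfolding F_def[symmetric] D_def[symmetric]
  proof (cases "\<beta>1 = 0")
    case True
    then have "\<alpha>1 \<le> D" using \<alpha>1_le by simp
    then have "\<alpha>1 * F \<le> D * F" using F by (intro mult_right_mono) auto
    also have "\<dots> \<le> D * \<alpha>2" using F\<alpha>2 D s by (intro mult_left_mono) auto
    finally show "\<alpha>1 * F \<le> D * \<alpha>2" .
  next
    case False
    then have "4 * w \<le> \<beta>2" using \<beta>1 by simp
    then have "(4 * w)\<^sup>2 \<le> \<beta>2\<^sup>2" using w by (intro power_mono) auto
    then have \<beta>w: "16 * w\<^sup>2 \<le> \<beta>2\<^sup>2" by (simp add: power_mult_distrib)
    then have \<beta>w': "w\<^sup>2 \<le> \<beta>2\<^sup>2" using zero_le_power2[of w] by linarith
    have "a \<le> 2 * s" "b \<le> 2 * s" using p q \<epsilon> by linarith+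
    then have "F + 2 * ((\<beta>2\<^sup>2 - w\<^sup>2) / (4 * s)) \<le> \<alpha>2"
      using quad_root_diff[of s w \<beta>2 a] quad_root_diff[of s w \<beta>2 b] s w \<beta> a0
      unfolding F_def \<alpha>2_def by linarith
    then have "D * (F + 2 * ((\<beta>2\<^sup>2 - w\<^sup>2) / (4 * s))) \<le> D * \<alpha>2"
      using D s by (intro mult_left_mono) auto
    \<comment> \<open>The term \<open>6 w^2\<close> separates gain and loss:
      \<open>4 * w \<le> \<beta>2\<close> makes the gain of \<alpha>2 over \<open>F\<close>, times
      \<open>D\<close>, at least that much, while the excess of \<alpha>1 over \<open>D\<close>,
      times \<open>F\<close>, is at most that much by \<open>F \<le> 3 * s\<close>.\<close>
    moreover have "6 * w\<^sup>2 \<le> D * (2 * ((\<beta>2\<^sup>2 - w\<^sup>2) / (4 * s)))"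
    proof -
      have "12 * w\<^sup>2 \<le> \<beta>2\<^sup>2 - w\<^sup>2" using \<beta>w zero_le_power2[of w] by linarith
      then have "6 * w\<^sup>2 \<le> (\<beta>2\<^sup>2 - w\<^sup>2) / 2" by simp
      also have "\<dots> = s * (2 * ((\<beta>2\<^sup>2 - w\<^sup>2) / (4 * s)))"
        using s by simp
      also have "\<dots> \<le> D * (2 * ((\<beta>2\<^sup>2 - w\<^sup>2) / (4 * s)))"
        using D s \<beta>w' by (intro mult_right_mono) auto
      finally show ?thesis .
    qed
    moreover have "2 * \<beta>1\<^sup>2 / D * F \<le> 6 * w\<^sup>2"
    proof -
      have "2 * \<beta>1\<^sup>2 / D * F \<le> 2 * w\<^sup>2 / s * (3 * s)"
        using \<beta> w D s F by (intro mult_mono frac_le power_mono) auto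
      then show ?thesis using s by simp
    qed
    moreover have "\<alpha>1 * F \<le> (D + 2 * \<beta>1\<^sup>2 / D) * F"
      using \<alpha>1_le F by (intro mult_right_mono) auto
    ultimately show "\<alpha>1 * F \<le> D * \<alpha>2" by (simp add: algebra_simps)
  qed
  \<comment> \<open>Against \<open>\<alpha>1 \<ge> D \<ge> 2 * s - 6 * \<epsilon>\<close> this
    leaves a gap of \<open>8 * \<epsilon> + 2 * B\<close>.\<close>
  have "\<alpha>2 \<le> 2 * s + 2 * \<epsilon> + 2 * B"
    using quad_root_le[of a \<beta>2] quad_root_le[of b \<beta>2] a0 p q \<beta> w unfolding \<alpha>2_def by linarith
  then have "\<alpha>2 - \<alpha>1 \<le> 8 * \<epsilon> + 2 * B" using \<alpha>1_ge p q by (simp add: D_def)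
  moreover have "s \<le> \<alpha>2" using \<alpha>2_ge p q D unfolding D_def by linarith
  moreover have "0 \<le> 8 * \<epsilon> + 2 * B" using \<epsilon> w \<beta> by linarith
  ultimately have "(\<alpha>2 - \<alpha>1) / \<alpha>2 \<le> (8 * \<epsilon> + 2 * B) / s"
    using s by (intro frac_le) auto
  then show "1 - (8 * \<epsilon> + 2 * B) / s \<le> \<alpha>1 / \<alpha>2"
    using \<alpha>2_pos by (simp add: diff_divide_distrib)
qed

text \<open>The deterministic core: the three closeness assumptions on the initial matrices already
  imply both inequalities.\<close>

lemma conclusion_of_concentration:
  fixes W1 :: "'n::finite hmat" and W2 :: "'m::finite hmat" and Wstar :: "real ^ 'm ^ 'n"
  assumes h: "CARD('n) \<le> h" "CARD('m) \<le> h" and K: "0 < \<mu>" "\<mu> \<le> K"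
    and s: "0 < s" and \<epsilon>: "0 \<le> \<epsilon>" "6 * \<epsilon> \<le> s"
    and W1: "\<And>x. \<bar>sqnorm_transp_app h W1 x - s * (norm x)\<^sup>2\<bar> \<le> \<epsilon> * (norm x)\<^sup>2"
    and W2: "\<And>x. \<bar>sqnorm_transp_app h W2 x - s * (norm x)\<^sup>2\<bar> \<le> \<epsilon> * (norm x)\<^sup>2"
    and W: "norm (W_prod h W1 W2) \<le> \<epsilon>"
    and B: "sigma_max Wstar + sqrt (K / \<mu>) * (norm Wstar + \<epsilon>) \<le> B" "B \<le> s"
    and \<epsilon>_Wstar: "Wstar \<noteq> 0 \<Longrightarrow> 4 * \<epsilon> \<le> sigma_max Wstar"
  shows "alpha1 K \<mu> Wstar h W1 W2 / alpha2 K \<mu> Wstar h W1 W2 \<le> sigma_min_T h W1 W2 / sigma_max_T h W1 W2"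
    and "1 - (8 * \<epsilon> + 2 * B) / s \<le> alpha1 K \<mu> Wstar h W1 W2 / alpha2 K \<mu> Wstar h W1 W2"
proof -
  have h0: "0 < h" using h(1) zero_less_card_finite[where 'a = 'n] by linarith
  define p where "p = max (eig CARD('n) (imbalance h W1 W2)) 0"
  define q where "q = max (eig CARD('m) (imbalance h W2 W1)) 0"
  define a where "a = lam_plus h W1 W2"
  define b where "b = lam_plus h W2 W1"
  define w where "w = norm (W_prod h W1 W2)"
  define \<beta>1 where "\<beta>1 = beta1 K \<mu> Wstar h W1 W2"
  define \<beta>2 where "\<beta>2 = beta2 K \<mu> Wstar h W1 W2"
  have lo: "(s - \<epsilon>) * (norm x)\<^sup>2 \<le> sqnorm_transp_app h W1 x" "(s - \<epsilon>) * (norm y)\<^sup>2 \<le> sqnorm_transp_app h W2 y" for x y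
    using W1[of x] W2[of y] by (simp_all add: algebra_simps abs_le_iff)
  have hi: "sqnorm_transp_app h W1 x \<le> (s + \<epsilon>) * (norm x)\<^sup>2" "sqnorm_transp_app h W2 y \<le> (s + \<epsilon>) * (norm y)\<^sup>2" for x y
    using W1[of x] W2[of y] by (simp_all add: algebra_simps abs_le_iff)
  have \<epsilon>2: "2 * \<epsilon> < s" and s\<epsilon>: "0 \<le> s + \<epsilon>" using s \<epsilon> by linarith+
  have p1: "s - 3 * \<epsilon> \<le> p"
    unfolding p_def using eig_imbalance_ge[OF h(1) \<epsilon>(1) \<epsilon>2 lo(1) W] by linarith
  have q1: "s - 3 * \<epsilon> \<le> q"
    unfolding q_def using eig_imbalance_ge[OF h(2) \<epsilon>(1) \<epsilon>2 lo(2), of W1] W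
    by (simp add: norm_W_prod_commute[of h W2 W1])
  have a1: "a \<le> s + \<epsilon>"
    unfolding a_def lam_plus_def using eig_max_imbalance_le[OF h0 s\<epsilon> hi(1)] s\<epsilon> by simp
  have b1: "b \<le> s + \<epsilon>"
    unfolding b_def lam_plus_def using eig_max_imbalance_le[OF h0 s\<epsilon> hi(2)] s\<epsilon> by simp
  have pa: "p \<le> a"
    unfolding p_def a_def lam_plus_def imbalance_eq
    by (intro max.mono eig_decreasing symm_on_gram_diff order.refl h) (simp_all add: Suc_leI)
  have qb: "q \<le> b"
    unfolding q_def b_def lam_plus_def imbalance_eq
    by (intro max.mono eig_decreasing symm_on_gram_diff order.refl h) (simp_all add: Suc_leI)
  have w: "0 \<le> w" "w \<le> \<epsilon>" using W by (simp_all add: w_def)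
  have K1: "1 \<le> sqrt (K / \<mu>)" using K by simp
  define d where "d = norm (W_prod h W1 W2 - Wstar)"
  have d: "0 \<le> d" "norm Wstar \<le> w + d" "d \<le> w + norm Wstar" "w \<le> norm Wstar + d"
    unfolding d_def w_def
    using norm_triangle_ineq4[of "W_prod h W1 W2" Wstar] norm_triangle_ineq2[of "W_prod h W1 W2" Wstar]
      norm_triangle_ineq3[of "W_prod h W1 W2" Wstar] by (auto simp: abs_le_iff)
  have kd: "d \<le> sqrt (K / \<mu>) * d" using K1 d mult_right_mono[of 1 "sqrt (K / \<mu>)" d] by simp
  \<comment> \<open>As \<open>K \<ge> \<mu>\<close>, a positive \<open>\<beta>1\<close> is at most
    \<open>norm Wstar - d\<close>, hence at most \<open>w\<close> by the triangle
    inequality.\<close>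
  have \<beta>1_w: "0 \<le> \<beta>1" "\<beta>1 \<le> w"
    using sigma_min_le_norm[of Wstar] kd d w unfolding \<beta>1_def beta1_def d_def[symmetric] by auto
  have \<beta>2_eq: "\<beta>2 = sigma_max Wstar + sqrt (K / \<mu>) * d"
    by (simp add: \<beta>2_def beta2_def d_def)
  have \<beta>2_B: "\<beta>2 \<le> B"
  proof -
    have "sqrt (K / \<mu>) * d \<le> sqrt (K / \<mu>) * (norm Wstar + \<epsilon>)"
      using d w K1 by (intro mult_left_mono) auto
    then show ?thesis using B \<beta>2_eq by linarith
  qed
  \<comment> \<open>For \<open>Wstar = 0\<close> the distance \<open>d\<close> equals
    \<open>w\<close>; otherwise \<open>4 * w \<le> 4 * \<epsilon> \<le> sigma_max Wstar \<le>
    \<beta>2\<close>.\<close>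
  have \<beta>2_ge: "w \<le> \<beta>2 \<and> (\<beta>1 = 0 \<or> 4 * w \<le> \<beta>2)"
  proof (cases "Wstar = 0")
    case True
    then have "\<beta>1 = 0"
      using sigma_min_le_norm[of Wstar] kd d unfolding \<beta>1_def beta1_def d_def[symmetric] by simp
    moreover have "w \<le> \<beta>2" using True \<beta>2_eq sigma_max_nonneg[of Wstar] kd d by simp
    ultimately show ?thesis by simp
  next
    case False
    then have "4 * w \<le> \<beta>2" using \<epsilon>_Wstar \<beta>2_eq kd d w by linarith
    then show ?thesis using w by linarith
  qed
  have \<alpha>1: "alpha1 K \<mu> Wstar h W1 W2 = (- (a - p) - (b - q) + sqrt ((a - p + (p + q))\<^sup>2 + 4 * \<beta>1\<^sup>2)
      + sqrt ((b - q + (p + q))\<^sup>2 + 4 * \<beta>1\<^sup>2)) / 2"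
    by (simp add: alpha1_def Delta_plus_def Delta_minus_def Delta_low_def lam_minus_eq uminus_imbalance
        a_def b_def p_def q_def \<beta>1_def)
  have \<alpha>2: "alpha2 K \<mu> Wstar h W1 W2 = quad_root a \<beta>2 + quad_root b \<beta>2"
    by (simp add: alpha2_def quad_root_def lam_minus_eq a_def b_def \<beta>2_def)
  note bounds = alpha_ratio_bounds[OF s \<epsilon> p1 pa a1 q1 qb b1 w \<beta>1_w conjunct1[OF \<beta>2_ge] \<beta>2_B B(2)
      conjunct2[OF \<beta>2_ge], folded \<alpha>1 \<alpha>2]
  show "1 - (8 * \<epsilon> + 2 * B) / s \<le> alpha1 K \<mu> Wstar h W1 W2 / alpha2 K \<mu> Wstar h W1 W2"
    by (rule bounds(3))
  define F where "F = quad_root a w + quad_root b w"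
  have "T_max h W1 W2 \<le> F"
    unfolding F_def a_def b_def w_def
    using sqnorm_transp_app_le_quad_root[OF h0, of W1 _ W2] sqnorm_transp_app_le_quad_root[OF h0, of W2 _ W1]
    by (intro T_max_le) (simp_all add: norm_W_prod_commute[of h W2 W1])
  moreover have Tmin: "p + q \<le> T_min h W1 W2"
    unfolding p_def q_def by (intro T_min_ge eig_le_sqnorm_transp_app h)
  moreover have pq: "0 < p + q" using p1 q1 s \<epsilon> by linarith
  moreover note T_min_le_T_max[of h W1 W2]
  ultimately have T: "0 < T_min h W1 W2" "T_min h W1 W2 \<le> T_max h W1 W2" "0 < F" "T_max h W1 W2 \<le> F"
    by linarith+
  \<comment> \<open>The product inequality of \<open>alpha_ratio_bounds\<close> divided by the
    positive \<open>F\<close> and \<open>alpha2\<close>.\<close>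
  have "alpha1 K \<mu> Wstar h W1 W2 / alpha2 K \<mu> Wstar h W1 W2 \<le> (p + q) / F"
    using bounds(1,2) T(3) unfolding F_def by (simp add: divide_le_eq le_divide_eq field_simps)
  also have "\<dots> \<le> T_min h W1 W2 / T_max h W1 W2"
    using Tmin T pq by (intro frac_le) auto
  also have "\<dots> \<le> sqrt (T_min h W1 W2 / T_max h W1 W2)"
  proof (rule real_le_rsqrt)
    define r where "r = T_min h W1 W2 / T_max h W1 W2"
    have "0 \<le> r" "r \<le> 1" using T by (simp_all add: r_def)
    then have "r\<^sup>2 \<le> r" by (simp add: power2_eq_square mult_left_le)
    then show "(T_min h W1 W2 / T_max h W1 W2)\<^sup>2 \<le> T_min h W1 W2 / T_max h W1 W2"
      by (simp only: r_def)
  qed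
  also have "\<dots> = sigma_min_T h W1 W2 / sigma_max_T h W1 W2"
    by (simp add: sigma_T_eq real_sqrt_divide)
  finally show "alpha1 K \<mu> Wstar h W1 W2 / alpha2 K \<mu> Wstar h W1 W2 \<le> sigma_min_T h W1 W2 / sigma_max_T h W1 W2" .
qed

section \<open>Measurability of the event\<close>

text \<open>
  \<open>measure\<close> is \<open>0\<close> on sets that are not measurable, so measurability of the event in the theorem is
  part of the claim. The eigenvalues are continuous by Weyl's inequality, and the extreme eigenvalues
  of \<open>T_op\<close> have closed sub- or superlevel sets.
\<close>

type_synonym ('n, 'm) stacked = "('n + 'm) \<Rightarrow> nat \<Rightarrow> real"

lemma continuous_on_entry: "continuous_on UNIV (\<lambda>G :: ('n, 'm) stacked. G r k)"
  using continuous_on_product_coordinates[of k] continuous_on_product_coordinates[of r]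
    continuous_on_compose2[of UNIV "\<lambda>x. x k" UNIV "\<lambda>G. G r"] by auto

lemma continuous_on_gram_diff:
  "continuous_on UNIV (\<lambda>G :: ('n::finite, 'm::finite) stacked. gram_diff (\<lambda>i. G (Inl i)) (\<lambda>j. G (Inr j)) k l)"
  unfolding gram_diff_def by (intro continuous_intros continuous_on_entry)

lemma abs_eig_diff_le:
  assumes "symm_on h a" "symm_on h a'" "0 < n" "n \<le> h"
  shows "\<bar>eig n (Matrix.mat h h (\<lambda>(k, l). a k l)) - eig n (Matrix.mat h h (\<lambda>(k, l). a' k l))\<bar>
    \<le> (\<Sum>k<h. \<Sum>l<h. \<bar>a k l - a' k l\<bar>)"
  using eig_perturb[OF assms] eig_perturb[OF assms(2,1,3,4)]
  by (simp add: abs_minus_commute[of "a' _ _"] abs_le_iff)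

lemma continuous_on_eig_imbalance:
  assumes "0 < i" "i \<le> h"
  shows "continuous_on UNIV (\<lambda>G :: ('n::finite, 'm::finite) stacked.
    eig i (imbalance h (\<lambda>i. G (Inl i)) (\<lambda>j. G (Inr j))))"
proof (rule continuous_at_imp_continuous_on, intro ballI)
  fix G0 :: "('n, 'm) stacked"
  define g where "g G = gram_diff (\<lambda>i. G (Inl i)) (\<lambda>j. G (Inr j))" for G :: "('n, 'm) stacked"
  define f where "f G = eig i (imbalance h (\<lambda>i. G (Inl i)) (\<lambda>j. G (Inr j)))" for G :: "('n, 'm) stacked"
  define S where "S G = (\<Sum>k<h. \<Sum>l<h. \<bar>g G k l - g G0 k l\<bar>)" for G
  have "continuous_on UNIV S"
    unfolding S_def g_def by (intro continuous_intros continuous_on_gram_diff)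
  then have "isCont S G0" by (simp add: continuous_on_eq_continuous_at)
  then have S: "S \<midarrow>G0\<rightarrow> 0" by (simp add: isCont_def S_def)
  have "norm (f G - f G0) \<le> S G" for G
    unfolding f_def S_def g_def imbalance_eq real_norm_def
    by (intro abs_eig_diff_le symm_on_gram_diff assms)
  then have "(\<lambda>G. f G - f G0) \<midarrow>G0\<rightarrow> 0"
    by (intro Lim_null_comparison[OF _ S]) simp
  then have "f \<midarrow>G0\<rightarrow> f G0" by (simp add: LIM_zero_iff)
  then show "isCont (\<lambda>G. eig i (imbalance h (\<lambda>i. G (Inl i)) (\<lambda>j. G (Inr j)))) G0"
    unfolding isCont_def f_def .
qed

lemma continuous_on_frob_inner_T_op:
  "continuous_on UNIV (\<lambda>G :: ('n::finite, 'm::finite) stacked.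
    frob_inner h (T_op (\<lambda>i. G (Inl i)) (\<lambda>j. G (Inr j)) U) (T_op (\<lambda>i. G (Inl i)) (\<lambda>j. G (Inr j)) U))"
  unfolding frob_inner_T_op trunc_inner_def transp_app_def by (intro continuous_intros continuous_on_entry)

text \<open>The sublevel set is an intersection of closed conditions over uncountably many
  \<open>U\<close>; working with closed sets instead of measurable ones makes this harmless.\<close>

lemma borel_measurable_T_max:
  "(\<lambda>G :: ('n::finite, 'm::finite) stacked. T_max h (\<lambda>i. G (Inl i)) (\<lambda>j. G (Inr j))) \<in> borel_measurable borel"
  unfolding borel_measurable_iff_le T_max_le_iff
proof
  fix a
  have "closed {G :: ('n, 'm) stacked. \<forall>U.
      frob_inner h (T_op (\<lambda>i. G (Inl i)) (\<lambda>j. G (Inr j)) U) (T_op (\<lambda>i. G (Inl i)) (\<lambda>j. G (Inr j)) U)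
        \<le> a * (norm U)\<^sup>2}"
    by (intro closed_Collect_all closed_Collect_le continuous_on_frob_inner_T_op continuous_intros)
  then show "{G \<in> space borel. \<forall>U.
      frob_inner h (T_op (\<lambda>i. (G :: ('n, 'm) stacked) (Inl i)) (\<lambda>j. G (Inr j)) U) (T_op (\<lambda>i. G (Inl i)) (\<lambda>j. G (Inr j)) U)
        \<le> a * (norm U)\<^sup>2} \<in> sets borel"
    by (simp add: borel_closed)
qed

lemma borel_measurable_T_min:
  "(\<lambda>G :: ('n::finite, 'm::finite) stacked. T_min h (\<lambda>i. G (Inl i)) (\<lambda>j. G (Inr j))) \<in> borel_measurable borel"
  unfolding borel_measurable_iff_ge T_min_ge_iff
proof
  fix a
  have "closed {G :: ('n, 'm) stacked. \<forall>U. a * (norm U)\<^sup>2 \<le>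
      frob_inner h (T_op (\<lambda>i. G (Inl i)) (\<lambda>j. G (Inr j)) U) (T_op (\<lambda>i. G (Inl i)) (\<lambda>j. G (Inr j)) U)}"
    by (intro closed_Collect_all closed_Collect_le continuous_on_frob_inner_T_op continuous_intros)
  then show "{G \<in> space borel. \<forall>U. a * (norm U)\<^sup>2 \<le>
      frob_inner h (T_op (\<lambda>i. (G :: ('n, 'm) stacked) (Inl i)) (\<lambda>j. G (Inr j)) U) (T_op (\<lambda>i. G (Inl i)) (\<lambda>j. G (Inr j)) U)}
       \<in> sets borel"
    by (simp add: borel_closed)
qed

lemma borel_measurable_W_prod:
  "(\<lambda>G :: ('n::finite, 'm::finite) stacked. W_prod h (\<lambda>i. G (Inl i)) (\<lambda>j. G (Inr j))) \<in> borel_measurable borel"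
  unfolding W_prod_def
  by (intro borel_measurable_continuous_onI continuous_intros continuous_on_vec_lambda continuous_on_entry)

text \<open>Only the entries in columns below \<open>h\<close> are known to be random variables.
  Zeroing the others makes the stacked pair measurable and leaves the relevant quantities
  unchanged.\<close>

definition restrict_cols :: "nat \<Rightarrow> 'r hmat \<Rightarrow> 'r hmat" where
  "restrict_cols h W = (\<lambda>r k. if k < h then W r k else 0)"

lemma
  shows imbalance_restrict_cols: "imbalance h (restrict_cols h W1) (restrict_cols h W2) = imbalance h W1 W2"
    and W_prod_restrict_cols: "W_prod h (restrict_cols h W1) (restrict_cols h W2) = W_prod h W1 W2"
    and T_max_restrict_cols: "T_max h (restrict_cols h W1) (restrict_cols h W2) = T_max h W1 W2"
    and T_min_restrict_cols: "T_min h (restrict_cols h W1) (restrict_cols h W2) = T_min h W1 W2"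
proof -
  have sq: "sqnorm_transp_app h (restrict_cols h W) x = sqnorm_transp_app h W x" for W :: "'z::finite hmat" and x
    by (rule trunc_inner_cong) (simp_all add: transp_app_def restrict_cols_def)
  show "imbalance h (restrict_cols h W1) (restrict_cols h W2) = imbalance h W1 W2"
    by (intro eq_matI) (auto simp: imbalance_def restrict_cols_def)
  show "W_prod h (restrict_cols h W1) (restrict_cols h W2) = W_prod h W1 W2"
    by (simp add: W_prod_def restrict_cols_def)
  have "T_max h (restrict_cols h W1) (restrict_cols h W2) \<le> c \<longleftrightarrow> T_max h W1 W2 \<le> c" for c
    by (simp add: T_max_le_iff frob_inner_T_op sq)
  then show "T_max h (restrict_cols h W1) (restrict_cols h W2) = T_max h W1 W2"
    by (metis order.antisym order.refl)
  have "c \<le> T_min h (restrict_cols h W1) (restrict_cols h W2) \<longleftrightarrow> c \<le> T_min h W1 W2" for c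
    by (simp add: T_min_ge_iff frob_inner_T_op sq)
  then show "T_min h (restrict_cols h W1) (restrict_cols h W2) = T_min h W1 W2"
    by (metis order.antisym order.refl)
qed

lemma borel_measurable_restrict_cols:
  fixes W1 :: "'w \<Rightarrow> 'n::finite hmat" and W2 :: "'w \<Rightarrow> 'm::finite hmat"
  assumes "\<And>e. e \<in> UNIV \<times> {..<h} \<Longrightarrow> (\<lambda>\<omega>. init_entry (W1 \<omega>) (W2 \<omega>) e) \<in> borel_measurable M"
  shows "(\<lambda>\<omega>. case_sum (restrict_cols h (W1 \<omega>)) (restrict_cols h (W2 \<omega>))) \<in> borel_measurable M"
proof (intro measurable_coordinatewise_then_product)
  fix r :: "'n + 'm" and k
  show "(\<lambda>\<omega>. case_sum (restrict_cols h (W1 \<omega>)) (restrict_cols h (W2 \<omega>)) r k) \<in> borel_measurable M"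
  proof (cases "k < h")
    case True
    then have "(\<lambda>\<omega>. case_sum (restrict_cols h (W1 \<omega>)) (restrict_cols h (W2 \<omega>)) r k)
        = (\<lambda>\<omega>. init_entry (W1 \<omega>) (W2 \<omega>) (r, k))"
      by (auto simp: restrict_cols_def init_entry_def split: sum.split)
    then show ?thesis using assms[of "(r, k)"] True by simp
  next
    case False
    then have "(\<lambda>\<omega>. case_sum (restrict_cols h (W1 \<omega>)) (restrict_cols h (W2 \<omega>)) r k) = (\<lambda>\<omega>. 0)"
      by (auto simp: restrict_cols_def split: sum.split)
    then show ?thesis by simp
  qed
qed

lemma measurable_conclusion:
  fixes W1 :: "'w \<Rightarrow> 'n::finite hmat" and W2 :: "'w \<Rightarrow> 'm::finite hmat"
  assumes ent: "\<And>e. e \<in> UNIV \<times> {..<h} \<Longrightarrow> (\<lambda>\<omega>. init_entry (W1 \<omega>) (W2 \<omega>) e) \<in> borel_measurable M"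
    and h: "CARD('n) \<le> h" "CARD('m) \<le> h"
  shows "{\<omega> \<in> space M.
            sigma_min_T h (W1 \<omega>) (W2 \<omega>) / sigma_max_T h (W1 \<omega>) (W2 \<omega>)
              \<ge> alpha1 K \<mu> Wstar h (W1 \<omega>) (W2 \<omega>) / alpha2 K \<mu> Wstar h (W1 \<omega>) (W2 \<omega>) \<and>
            alpha1 K \<mu> Wstar h (W1 \<omega>) (W2 \<omega>) / alpha2 K \<mu> Wstar h (W1 \<omega>) (W2 \<omega>) \<ge> c} \<in> sets M"
proof -
  note G = borel_measurable_restrict_cols[of h W1 W2 M, OF ent]
  have h0: "0 < h" using h(1) zero_less_card_finite[where 'a = 'n] by linarith
  have eig[measurable]: "(\<lambda>\<omega>. eig i (imbalance h (W1 \<omega>) (W2 \<omega>))) \<in> borel_measurable M"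
    "(\<lambda>\<omega>. eig i (imbalance h (W2 \<omega>) (W1 \<omega>))) \<in> borel_measurable M" if "0 < i" "i \<le> h" for i
  proof -
    show "(\<lambda>\<omega>. eig i (imbalance h (W1 \<omega>) (W2 \<omega>))) \<in> borel_measurable M"
      using measurable_compose[OF G borel_measurable_continuous_onI[OF continuous_on_eig_imbalance[OF that]]]
      by (simp add: imbalance_restrict_cols)
    \<comment> \<open>The stack in the opposite order handles \<open>-D(0)\<close>.\<close>
    have G': "(\<lambda>\<omega>. case_sum (restrict_cols h (W2 \<omega>)) (restrict_cols h (W1 \<omega>))) \<in> borel_measurable M"
    proof (rule borel_measurable_restrict_cols)
      fix e :: "('m + 'n) \<times> nat" assume e: "e \<in> UNIV \<times> {..<h}"
      show "(\<lambda>\<omega>. init_entry (W2 \<omega>) (W1 \<omega>) e) \<in> borel_measurable M"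
        using ent[of "(case fst e of Inl j \<Rightarrow> Inr j | Inr i \<Rightarrow> Inl i, snd e)"] e
        by (cases e; cases "fst e") (auto simp: init_entry_def)
    qed
    show "(\<lambda>\<omega>. eig i (imbalance h (W2 \<omega>) (W1 \<omega>))) \<in> borel_measurable M"
      using measurable_compose[OF G' borel_measurable_continuous_onI[OF continuous_on_eig_imbalance[OF that]]]
      by (simp add: imbalance_restrict_cols)
  qed
  have W[measurable]: "(\<lambda>\<omega>. W_prod h (W1 \<omega>) (W2 \<omega>)) \<in> borel_measurable M"
    using measurable_compose[OF G borel_measurable_W_prod[of h]] by (simp add: W_prod_restrict_cols)
  have T[measurable]: "(\<lambda>\<omega>. T_max h (W1 \<omega>) (W2 \<omega>)) \<in> borel_measurable M"
    "(\<lambda>\<omega>. T_min h (W1 \<omega>) (W2 \<omega>)) \<in> borel_measurable M"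
    using measurable_compose[OF G borel_measurable_T_max[of h]] measurable_compose[OF G borel_measurable_T_min[of h]]
    by (simp_all add: T_max_restrict_cols T_min_restrict_cols)
  have 1: "1 \<le> h" using h0 by simp
  \<comment> \<open>Indices 1, \<open>n\<close> and \<open>m\<close> are those that occur in
    \<open>alpha1\<close> and \<open>alpha2\<close>.\<close>
  note eigs[measurable] = eig[OF _ 1] eig[OF _ h(1)] eig[OF _ h(2)]
  have lam[measurable]: "(\<lambda>\<omega>. lam_plus h (W1 \<omega>) (W2 \<omega>)) \<in> borel_measurable M"
    "(\<lambda>\<omega>. lam_minus h (W1 \<omega>) (W2 \<omega>)) \<in> borel_measurable M"
    unfolding lam_plus_def lam_minus_def uminus_imbalance using eigs by (auto intro!: borel_measurable_max)
  have Delta[measurable]: "(\<lambda>\<omega>. Delta_low h (W1 \<omega>) (W2 \<omega>)) \<in> borel_measurable M"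
    "(\<lambda>\<omega>. Delta_plus h (W1 \<omega>) (W2 \<omega>)) \<in> borel_measurable M"
    "(\<lambda>\<omega>. Delta_minus h (W1 \<omega>) (W2 \<omega>)) \<in> borel_measurable M"
    unfolding Delta_low_def Delta_plus_def Delta_minus_def uminus_imbalance
    using eigs lam by (auto intro!: borel_measurable_max borel_measurable_add borel_measurable_diff)
  have \<alpha>[measurable]: "(\<lambda>\<omega>. alpha1 K \<mu> Wstar h (W1 \<omega>) (W2 \<omega>)) \<in> borel_measurable M"
    "(\<lambda>\<omega>. alpha2 K \<mu> Wstar h (W1 \<omega>) (W2 \<omega>)) \<in> borel_measurable M"
    unfolding alpha1_def alpha2_def beta1_def beta2_def by measurable
  show ?thesis unfolding sigma_T_eq by measurable
qed

section \<open>Gaussian concentration\<close>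

lemma
  assumes "0 < \<sigma>" and X: "distributed M lborel X (\<lambda>x. ennreal (normal_density 0 \<sigma> x))"
  shows normal_integrable_power: "integrable M (\<lambda>\<omega>. X \<omega> ^ k)"
    and normal_moment_1: "integral\<^sup>L M X = 0"
    and normal_moment_2: "integral\<^sup>L M (\<lambda>\<omega>. X \<omega> ^ 2) = \<sigma>\<^sup>2"
    and normal_moment_4: "integral\<^sup>L M (\<lambda>\<omega>. X \<omega> ^ 4) = 3 * \<sigma> ^ 4"
proof -
  show "integrable M (\<lambda>\<omega>. X \<omega> ^ k)"
    using integrable_normal_moment[OF assms(1), of 0 k] distributed_integrable[OF X, of "\<lambda>x. x ^ k"]
    by simp
  have eq: "integral\<^sup>L M (\<lambda>\<omega>. X \<omega> ^ k) = integral\<^sup>L lborel (\<lambda>x. normal_density 0 \<sigma> x * (x - 0) ^ k)" for k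
    using distributed_integral[OF X, of "\<lambda>x. x ^ k"] by simp
  show "integral\<^sup>L M X = 0"
    using eq[of 1] integral_normal_moment_odd[OF assms(1), of 0 0] by simp
  show "integral\<^sup>L M (\<lambda>\<omega>. X \<omega> ^ 2) = \<sigma>\<^sup>2"
    using eq[of 2] integral_normal_moment_even[OF assms(1), of 0 1] by (simp add: fact_numeral)
  show "integral\<^sup>L M (\<lambda>\<omega>. X \<omega> ^ 4) = 3 * \<sigma> ^ 4"
    using eq[of 4] integral_normal_moment_even[OF assms(1), of 0 2]
    by (simp add: fact_numeral power_divide field_simps)
qed

context prob_space
begin

lemma
  fixes X :: "'i \<Rightarrow> 'a \<Rightarrow> real" and g :: "'i \<Rightarrow> real \<Rightarrow> real"
  assumes "indep_vars (\<lambda>_. borel) X I" "J \<subseteq> I" "finite J" "\<And>e. e \<in> J \<Longrightarrow> g e \<in> borel_measurable borel"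
    "\<And>e. e \<in> J \<Longrightarrow> integrable M (\<lambda>\<omega>. g e (X e \<omega>))"
  shows indep_integrable_prod: "integrable M (\<lambda>\<omega>. \<Prod>e\<in>J. g e (X e \<omega>))"
    and indep_expectation_prod: "expectation (\<lambda>\<omega>. \<Prod>e\<in>J. g e (X e \<omega>)) = (\<Prod>e\<in>J. expectation (\<lambda>\<omega>. g e (X e \<omega>)))"
proof -
  have ind: "indep_vars (\<lambda>_. borel) (\<lambda>e \<omega>. g e (X e \<omega>)) J"
    using assms by (intro indep_vars_compose2[OF indep_vars_subset[OF assms(1,2)]])
  show "integrable M (\<lambda>\<omega>. \<Prod>e\<in>J. g e (X e \<omega>))"
    using assms by (intro indep_vars_integrable[OF _ ind])
  show "expectation (\<lambda>\<omega>. \<Prod>e\<in>J. g e (X e \<omega>)) = (\<Prod>e\<in>J. expectation (\<lambda>\<omega>. g e (X e \<omega>)))"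
    using assms by (intro indep_vars_lebesgue_integral[OF _ ind])
qed

text \<open>Chebyshev's inequality: the cross terms of the second moment vanish and \<open>h\<close>
  diagonal terms remain.\<close>

lemma uncorrelated_sum_deviation:
  fixes Z :: "nat \<Rightarrow> 'a \<Rightarrow> real"
  assumes meas: "\<And>k. k < h \<Longrightarrow> Z k \<in> borel_measurable M"
    and int: "\<And>k l. k < h \<Longrightarrow> l < h \<Longrightarrow> integrable M (\<lambda>\<omega>. Z k \<omega> * Z l \<omega>)"
    and zero: "\<And>k l. k < h \<Longrightarrow> l < h \<Longrightarrow> k \<noteq> l \<Longrightarrow> expectation (\<lambda>\<omega>. Z k \<omega> * Z l \<omega>) = 0"
    and var: "\<And>k. k < h \<Longrightarrow> expectation (\<lambda>\<omega>. Z k \<omega> * Z k \<omega>) \<le> v"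
    and "\<eta> > 0"
  shows "prob {\<omega> \<in> space M. \<eta> \<le> \<bar>\<Sum>k<h. Z k \<omega>\<bar>} \<le> real h * v / \<eta>\<^sup>2"
proof -
  have sq: "(\<Sum>k<h. Z k \<omega>)\<^sup>2 = (\<Sum>k<h. \<Sum>l<h. Z k \<omega> * Z l \<omega>)" for \<omega>
    by (simp add: power2_eq_square sum_product)
  have "prob {\<omega> \<in> space M. \<eta> \<le> \<bar>\<Sum>k<h. Z k \<omega>\<bar>} \<le> expectation (\<lambda>\<omega>. (\<Sum>k<h. Z k \<omega>)\<^sup>2) / \<eta>\<^sup>2"
  proof (rule second_moment_method)
    show "integrable M (\<lambda>\<omega>. (\<Sum>k<h. Z k \<omega>)\<^sup>2)"
      unfolding sq using int by (intro Bochner_Integration.integrable_sum) auto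
  qed (use assms(5) meas in auto)
  also have "expectation (\<lambda>\<omega>. (\<Sum>k<h. Z k \<omega>)\<^sup>2) = (\<Sum>k<h. \<Sum>l<h. expectation (\<lambda>\<omega>. Z k \<omega> * Z l \<omega>))"
  proof -
    have "expectation (\<lambda>\<omega>. \<Sum>k<h. \<Sum>l<h. Z k \<omega> * Z l \<omega>) = (\<Sum>k<h. expectation (\<lambda>\<omega>. \<Sum>l<h. Z k \<omega> * Z l \<omega>))"
      using int by (intro Bochner_Integration.integral_sum Bochner_Integration.integrable_sum) auto
    also have "\<dots> = (\<Sum>k<h. \<Sum>l<h. expectation (\<lambda>\<omega>. Z k \<omega> * Z l \<omega>))"
      using int by (intro sum.cong refl Bochner_Integration.integral_sum) auto
    finally show ?thesis unfolding sq .
  qed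
  also have "\<dots> = (\<Sum>k<h. \<Sum>l<h. if l = k then expectation (\<lambda>\<omega>. Z k \<omega> * Z k \<omega>) else 0)"
    using zero by (intro sum.cong refl) auto
  also have "\<dots> = (\<Sum>k<h. expectation (\<lambda>\<omega>. Z k \<omega> * Z k \<omega>))"
    by simp
  also have "\<dots> \<le> (\<Sum>k<h. v)" using var by (intro sum_mono) auto
  finally show ?thesis using assms(5) by (simp add: divide_right_mono)
qed

text \<open>The summands \<open>Z k\<close> are centred and uncorrelated. Their variance is
  \<open>2 \<sigma>^4\<close> for \<open>r = r'\<close>, from the fourth moment
  \<open>3 \<sigma>^4\<close>, and \<open>\<sigma>^4\<close> otherwise.\<close>

lemma gaussian_gram_deviation:
  fixes X :: "'r \<times> nat \<Rightarrow> 'a \<Rightarrow> real"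
  assumes ind: "indep_vars (\<lambda>_. borel) X (UNIV \<times> {..<h})"
    and dist: "\<And>e. e \<in> UNIV \<times> {..<h} \<Longrightarrow> distributed M lborel (X e) (\<lambda>x. ennreal (normal_density 0 \<sigma> x))"
    and \<sigma>: "0 < \<sigma>" and \<eta>: "0 < \<eta>"
  shows "prob {\<omega> \<in> space M. \<eta> \<le> \<bar>(\<Sum>k<h. X (r, k) \<omega> * X (r', k) \<omega>) - of_bool (r = r') * (real h * \<sigma>\<^sup>2)\<bar>}
    \<le> real h * (2 * \<sigma> ^ 4) / \<eta>\<^sup>2"
proof -
  define Z where "Z k \<omega> = X (r, k) \<omega> * X (r', k) \<omega> - of_bool (r = r') * \<sigma>\<^sup>2" for k \<omega>
  have meas: "X e \<in> borel_measurable M" if "e \<in> UNIV \<times> {..<h}" for e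
    using distributed_measurable[OF dist[OF that]] by simp
  note X = normal_integrable_power[OF \<sigma> dist] normal_moment_1[OF \<sigma> dist] normal_moment_2[OF \<sigma> dist]
    normal_moment_4[OF \<sigma> dist]
  have X1: "integrable M (X e)" if "e \<in> UNIV \<times> {..<h}" for e
    using X(1)[OF that, of 1] by simp
  have Zprod: "integrable M (\<lambda>\<omega>. Z k \<omega> * Z l \<omega>) \<and>
      expectation (\<lambda>\<omega>. Z k \<omega> * Z l \<omega>) \<le> (if k = l then 2 * \<sigma> ^ 4 else 0) \<and>
      (k \<noteq> l \<longrightarrow> expectation (\<lambda>\<omega>. Z k \<omega> * Z l \<omega>) = 0)" if kl: "k < h" "l < h" for k l
  proof (cases "r = r'")
    case eq: True
    define g where "g x = x\<^sup>2 - \<sigma>\<^sup>2" for x :: real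
    have gm: "g \<in> borel_measurable borel" unfolding g_def by measurable
    have Z: "Z k \<omega> = g (X (r, k) \<omega>)" for k \<omega>
      using eq by (simp add: Z_def g_def power2_eq_square)
    have gint: "integrable M (\<lambda>\<omega>. g (X (r, k) \<omega>))" "expectation (\<lambda>\<omega>. g (X (r, k) \<omega>)) = 0" if "k < h" for k
      unfolding g_def using X(1,3)[of "(r, k)"] that by (simp_all add: prob_space)
    show ?thesis
    proof (cases "k = l")
      case True
      have gg: "Z k \<omega> * Z k \<omega> = X (r, k) \<omega> ^ 4 - 2 * \<sigma>\<^sup>2 * X (r, k) \<omega> ^ 2 + \<sigma> ^ 4" for \<omega>
        by (simp add: Z g_def power2_eq_square power4_eq_xxxx algebra_simps)
      have "expectation (\<lambda>\<omega>. Z k \<omega> * Z k \<omega>) = 3 * \<sigma> ^ 4 - 2 * \<sigma>\<^sup>2 * \<sigma>\<^sup>2 + \<sigma> ^ 4"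
        unfolding gg using X(1,3,4)[of "(r, k)"] kl by (simp add: prob_space)
      moreover have "integrable M (\<lambda>\<omega>. Z k \<omega> * Z k \<omega>)"
        unfolding gg using X(1)[of "(r, k)"] kl by simp
      ultimately show ?thesis using True by (simp add: power2_eq_square power4_eq_xxxx)
    next
      case False
      have "{(r, k), (r, l)} \<subseteq> UNIV \<times> {..<h}" using kl by auto
      note P = indep_integrable_prod[OF ind this, of "\<lambda>_. g"] indep_expectation_prod[OF ind this, of "\<lambda>_. g"]
      have "integrable M (\<lambda>\<omega>. \<Prod>e\<in>{(r, k), (r, l)}. g (X e \<omega>))"
        using gint kl gm by (intro P) auto
      moreover have "expectation (\<lambda>\<omega>. \<Prod>e\<in>{(r, k), (r, l)}. g (X e \<omega>)) = 0"
        using gint kl gm False by (subst P) auto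
      ultimately show ?thesis using False by (simp add: Z)
    qed
  next
    case neq: False
    have Z: "Z k \<omega> = X (r, k) \<omega> * X (r', k) \<omega>" for k \<omega>
      using neq by (simp add: Z_def)
    show ?thesis
    proof (cases "k = l")
      case True
      have "{(r, k), (r', k)} \<subseteq> UNIV \<times> {..<h}" using kl by auto
      note P = indep_integrable_prod[OF ind this, of "\<lambda>_ x. x ^ 2"] indep_expectation_prod[OF ind this, of "\<lambda>_ x. x ^ 2"]
      have "integrable M (\<lambda>\<omega>. \<Prod>e\<in>{(r, k), (r', k)}. (X e \<omega>)\<^sup>2)"
        using X(1) kl by (intro P) auto
      moreover have "expectation (\<lambda>\<omega>. \<Prod>e\<in>{(r, k), (r', k)}. (X e \<omega>)\<^sup>2) = \<sigma>\<^sup>2 * \<sigma>\<^sup>2"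
        using X(1,3) kl neq by (subst P) auto
      moreover have "(\<Prod>e\<in>{(r, k), (r', k)}. (X e \<omega>)\<^sup>2) = Z k \<omega> * Z l \<omega>" for \<omega>
        using neq True by (simp add: Z power2_eq_square mult_ac)
      ultimately show ?thesis using True \<sigma> by (simp add: power2_eq_square power4_eq_xxxx)
    next
      case False
      \<comment> \<open>Four distinct entries, so the product over this set has four factors, each
        of mean zero.\<close>
      have "{(r, k), (r', k), (r, l), (r', l)} \<subseteq> UNIV \<times> {..<h}" using kl by auto
      note P = indep_integrable_prod[OF ind this, of "\<lambda>_ x. x"] indep_expectation_prod[OF ind this, of "\<lambda>_ x. x"]
      have "integrable M (\<lambda>\<omega>. \<Prod>e\<in>{(r, k), (r', k), (r, l), (r', l)}. X e \<omega>)"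
        using X1 kl by (intro P) auto
      moreover have "expectation (\<lambda>\<omega>. \<Prod>e\<in>{(r, k), (r', k), (r, l), (r', l)}. X e \<omega>) = 0"
        using X1 X(2) kl neq by (subst P) auto
      moreover have "(\<Prod>e\<in>{(r, k), (r', k), (r, l), (r', l)}. X e \<omega>) = Z k \<omega> * Z l \<omega>" for \<omega>
        using neq False by (simp add: Z mult_ac)
      ultimately show ?thesis using False by simp
    qed
  qed
  have sum: "(\<Sum>k<h. X (r, k) \<omega> * X (r', k) \<omega>) - of_bool (r = r') * (real h * \<sigma>\<^sup>2) = (\<Sum>k<h. Z k \<omega>)" for \<omega>
    by (simp add: Z_def sum_subtractf)
  show ?thesis
    unfolding sum
  proof (rule uncorrelated_sum_deviation[OF _ _ _ _ \<eta>])
    show "Z k \<in> borel_measurable M" if "k < h" for k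
      unfolding Z_def[abs_def] using meas[of "(r, k)"] meas[of "(r', k)"] that
      by (intro borel_measurable_diff borel_measurable_times) auto
    show "integrable M (\<lambda>\<omega>. Z k \<omega> * Z l \<omega>)" if "k < h" "l < h" for k l
      using Zprod[OF that] by blast
    show "expectation (\<lambda>\<omega>. Z k \<omega> * Z l \<omega>) = 0" if "k < h" "l < h" "k \<noteq> l" for k l
      using Zprod[OF that(1,2)] that(3) by blast
    show "expectation (\<lambda>\<omega>. Z k \<omega> * Z k \<omega>) \<le> 2 * \<sigma> ^ 4" if "k < h" for k
      using Zprod[OF that that] by simp
  qed
qed

end

section \<open>Simultaneous concentration of all Gram entries\<close>

lemma init_entry_simps: "init_entry W1 W2 (Inl i, k) = W1 i k" "init_entry W1 W2 (Inr j, k) = W2 j k"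
  by (simp_all add: init_entry_def)

text \<open>Union bound over the \<open>(n + m)^2\<close> pairs of rows of the stacked matrix; its
  Gram matrix contains those of \<open>W1\<close> and \<open>W2\<close> and the product
  \<open>W(0)\<close>.\<close>

lemma gaussian_init_concentration:
  fixes W1 :: "'w \<Rightarrow> 'n::finite hmat" and W2 :: "'w \<Rightarrow> 'm::finite hmat"
  assumes "prob_space M" and init: "iid_normal_init M h \<sigma> W1 W2" and \<sigma>: "0 < \<sigma>" and \<eta>: "0 < \<eta>"
  defines "X \<equiv> \<lambda>e \<omega>. init_entry (W1 \<omega>) (W2 \<omega>) e"
  shows "\<exists>A\<in>sets M. (\<forall>\<omega>\<in>A. \<forall>r r'. \<bar>(\<Sum>k<h. X (r, k) \<omega> * X (r', k) \<omega>) - of_bool (r = r') * (real h * \<sigma>\<^sup>2)\<bar> \<le> \<eta>) \<and>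
    1 - (real (CARD('n) + CARD('m)))\<^sup>2 * (real h * (2 * \<sigma> ^ 4) / \<eta>\<^sup>2) \<le> measure M A"
proof -
  interpret prob_space M by fact
  define D where "D r r' \<omega> = (\<Sum>k<h. X (r, k) \<omega> * X (r', k) \<omega>) - of_bool (r = r') * (real h * \<sigma>\<^sup>2)" for r r' \<omega>
  have ind: "indep_vars (\<lambda>_. borel) X (UNIV \<times> {..<h})"
    and dist: "\<And>e. e \<in> UNIV \<times> {..<h} \<Longrightarrow> distributed M lborel (X e) (\<lambda>x. ennreal (normal_density 0 \<sigma> x))"
    using init by (auto simp: iid_normal_init_def X_def)
  have meas: "X e \<in> borel_measurable M" if "e \<in> UNIV \<times> {..<h}" for e
    using distributed_measurable[OF dist[OF that]] by simp
  have D_meas: "D r r' \<in> borel_measurable M" for r r'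
    unfolding D_def[abs_def] using meas
    by (intro borel_measurable_diff borel_measurable_sum borel_measurable_times) auto
  define Bad where "Bad = (\<lambda>(r, r'). {\<omega> \<in> space M. \<eta> \<le> \<bar>D r r' \<omega>\<bar>})"
  have Bad: "Bad rr \<in> sets M" for rr
    using D_meas by (auto simp: Bad_def split: prod.split)
  have "prob (\<Union>rr\<in>UNIV. Bad rr) \<le> (\<Sum>rr\<in>UNIV. prob (Bad rr))"
    using Bad by (intro finite_measure_subadditive_finite) auto
  also have "\<dots> \<le> (\<Sum>rr\<in>(UNIV :: (('n + 'm) \<times> ('n + 'm)) set). real h * (2 * \<sigma> ^ 4) / \<eta>\<^sup>2)"
    using gaussian_gram_deviation[OF ind dist \<sigma> \<eta>] by (intro sum_mono) (auto simp: Bad_def D_def)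
  also have "\<dots> = (real (CARD('n) + CARD('m)))\<^sup>2 * (real h * (2 * \<sigma> ^ 4) / \<eta>\<^sup>2)"
    by (simp add: card_cartesian_product power2_eq_square flip: UNIV_Times_UNIV)
  finally have "1 - (real (CARD('n) + CARD('m)))\<^sup>2 * (real h * (2 * \<sigma> ^ 4) / \<eta>\<^sup>2) \<le> prob (space M - (\<Union>rr\<in>UNIV. Bad rr))"
    using Bad by (subst prob_compl) auto
  then show ?thesis
    using Bad by (intro bexI[of _ "space M - (\<Union>rr\<in>UNIV. Bad rr)"])
      (auto simp: Bad_def D_def not_le less_imp_le)
qed

text \<open>An entrywise error \<open>\<eta>\<close> costs at most \<open>\<eta>\<close> times the
  squared sum of the \<open>|x_i|\<close>, and Cauchy-Schwarz turns this into the number of rows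
  times \<open>|x|^2\<close>.\<close>

lemma sqnorm_transp_app_deviation:
  fixes W :: "'r::finite hmat"
  assumes G: "\<And>i j. \<bar>trunc_inner h (W i) (W j) - of_bool (i = j) * s\<bar> \<le> \<eta>"
  shows "\<bar>sqnorm_transp_app h W x - s * (norm x)\<^sup>2\<bar> \<le> real CARD('r) * \<eta> * (norm x)\<^sup>2"
proof -
  have "0 \<le> \<eta>" using G[of undefined undefined] by linarith
  have "sqnorm_transp_app h W x = (\<Sum>i\<in>UNIV. x $ i * (\<Sum>j\<in>UNIV. x $ j * trunc_inner h (W i) (W j)))"
  proof -
    have "trunc_inner h (W i) (transp_app W x) = (\<Sum>j\<in>UNIV. x $ j * trunc_inner h (W i) (W j))" for i
      unfolding transp_app_def trunc_inner_sum_right trunc_inner_scale_right ..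
    then show ?thesis by (simp add: trunc_inner_transp_app trunc_app_def inner_vec_def)
  qed
  moreover have "s * (norm x)\<^sup>2 = (\<Sum>i\<in>UNIV. x $ i * (\<Sum>j\<in>UNIV. x $ j * (of_bool (i = j) * s)))"
  proof -
    have "(\<Sum>j\<in>UNIV. x $ j * (of_bool (i = j) * s)) = (\<Sum>j\<in>UNIV. if j = i then x $ j * s else 0)" for i
      by (intro sum.cong) auto
    then have "(\<Sum>j\<in>UNIV. x $ j * (of_bool (i = j) * s)) = x $ i * s" for i by simp
    then show ?thesis by (simp only: norm_vec_squared) (simp add: sum_distrib_left power2_eq_square mult_ac)
  qed
  ultimately have "sqnorm_transp_app h W x - s * (norm x)\<^sup>2
      = (\<Sum>i\<in>UNIV. \<Sum>j\<in>UNIV. x $ i * x $ j * (trunc_inner h (W i) (W j) - of_bool (i = j) * s))"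
    by (simp add: sum_subtractf sum_distrib_left algebra_simps)
  also have "\<bar>\<dots>\<bar> \<le> (\<Sum>i\<in>UNIV. \<Sum>j\<in>UNIV. \<bar>x $ i * x $ j * (trunc_inner h (W i) (W j) - of_bool (i = j) * s)\<bar>)"
    by (rule order_trans[OF sum_abs sum_mono[OF sum_abs]])
  also have "\<dots> \<le> (\<Sum>i\<in>UNIV. \<Sum>j\<in>UNIV. \<bar>x $ i\<bar> * \<bar>x $ j\<bar> * \<eta>)"
    unfolding abs_mult by (intro sum_mono mult_left_mono G) auto
  also have "\<dots> = (\<Sum>i\<in>UNIV. \<bar>x $ i\<bar> * 1)\<^sup>2 * \<eta>"
    by (simp only: power2_eq_square mult_1_right sum_product) (simp only: sum_distrib_right)
  also have "\<dots> \<le> ((\<Sum>i\<in>UNIV. \<bar>x $ i\<bar>\<^sup>2) * (\<Sum>i\<in>(UNIV :: 'r set). 1\<^sup>2)) * \<eta>"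
    using \<open>0 \<le> \<eta>\<close> by (intro mult_right_mono Cauchy_Schwarz_ineq_sum)
  finally show ?thesis by (simp add: norm_vec_squared mult_ac)
qed

text \<open>The factor \<open>n + m\<close> is a convenient bound for the square root of
  \<open>n m\<close>; it lets one constant serve all three matrices.\<close>

lemma norm_le_of_entries:
  fixes A :: "real ^ 'm::finite ^ 'n::finite"
  assumes "\<And>i j. \<bar>(A $ i) $ j\<bar> \<le> \<eta>"
  shows "norm A \<le> real (CARD('n) + CARD('m)) * \<eta>"
proof -
  have \<eta>: "0 \<le> \<eta>" using assms[of undefined undefined] by linarith
  have "(norm A)\<^sup>2 = (\<Sum>i\<in>UNIV. \<Sum>j\<in>UNIV. \<bar>(A $ i) $ j\<bar>\<^sup>2)"
    by (simp add: norm_vec_squared)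
  also have "\<dots> \<le> (\<Sum>i\<in>(UNIV :: 'n set). \<Sum>j\<in>(UNIV :: 'm set). \<eta>\<^sup>2)"
    by (intro sum_mono power_mono assms) auto
  also have "\<dots> \<le> (real (CARD('n) + CARD('m)) * \<eta>)\<^sup>2"
    using \<eta> by (simp add: power2_eq_square algebra_simps)
  finally show ?thesis by (rule power2_le_imp_le) (use \<eta> in simp)
qed

section \<open>Choice of the constants\<close>

text \<open>For a unit step from 0, the upper and lower quadratic bounds share the linear
  term.\<close>

lemma strongly_convex_le_smooth:
  fixes f :: "'a::euclidean_space \<Rightarrow> real"
  assumes "K_smooth K f" "strongly_convex \<mu> f"
  shows "\<mu> \<le> K"
proof -
  obtain b :: 'a where "b \<in> Basis" using nonempty_Basis by blast
  then have "norm (b - 0) = 1" by simp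
  moreover have "f b \<le> f 0 + inner (gradient f 0) (b - 0) + K / 2 * (norm (b - 0))\<^sup>2"
    using assms(1) by (simp only: K_smooth_def)
  moreover have "f 0 + inner (gradient f 0) (b - 0) + \<mu> / 2 * (norm (b - 0))\<^sup>2 \<le> f b"
    using assms(2) by (simp only: strongly_convex_def)
  ultimately show ?thesis by simp
qed

lemma powr_ge_of_ge_root:
  fixes x h a :: real
  assumes "1 \<le> x" "0 < a" "x powr (1 / a) \<le> h"
  shows "x \<le> h powr a"
proof -
  have "(x powr (1 / a)) powr a \<le> h powr a"
    using assms by (intro powr_mono2) auto
  then show ?thesis using assms by (simp add: powr_powr)
qed

text \<open>Entrywise tolerance \<open>\<eta> = \<epsilon> / N\<close> makes all three errors at
  most \<open>\<epsilon>\<close>, and it turns the failure probability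
  \<open>2 N^2 h \<sigma>^4 / \<eta>^2\<close> into the expression bounded by
  \<open>\<delta>\<close>.\<close>

lemma gaussian_init_conclusion:
  fixes W1 :: "'w \<Rightarrow> 'n::finite hmat" and W2 :: "'w \<Rightarrow> 'm::finite hmat" and Wstar :: "real ^ 'm ^ 'n"
  assumes M: "prob_space M" and init: "iid_normal_init M h \<sigma> W1 W2" and \<sigma>: "0 < \<sigma>"
    and h: "CARD('n) + CARD('m) \<le> h" and K: "0 < \<mu>" "\<mu> \<le> K"
    and s: "real h * \<sigma>\<^sup>2 = s" "6 * \<epsilon> \<le> s" and \<epsilon>: "0 < \<epsilon>"
    and \<delta>: "2 * (real (CARD('n) + CARD('m))) ^ 4 / \<epsilon>\<^sup>2 * (real h * \<sigma> ^ 4) \<le> \<delta>"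
    and B: "sigma_max Wstar + sqrt (K / \<mu>) * (norm Wstar + \<epsilon>) \<le> B" "B \<le> s"
    and \<epsilon>_Wstar: "Wstar \<noteq> 0 \<Longrightarrow> 4 * \<epsilon> \<le> sigma_max Wstar"
  shows "1 - \<delta> \<le> measure M {\<omega> \<in> space M.
            sigma_min_T h (W1 \<omega>) (W2 \<omega>) / sigma_max_T h (W1 \<omega>) (W2 \<omega>)
              \<ge> alpha1 K \<mu> Wstar h (W1 \<omega>) (W2 \<omega>) / alpha2 K \<mu> Wstar h (W1 \<omega>) (W2 \<omega>) \<and>
            alpha1 K \<mu> Wstar h (W1 \<omega>) (W2 \<omega>) / alpha2 K \<mu> Wstar h (W1 \<omega>) (W2 \<omega>)
              \<ge> 1 - (8 * \<epsilon> + 2 * B) / s}"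
    (is "_ \<le> measure M ?good")
proof -
  interpret prob_space M by fact
  define N where "N = real (CARD('n) + CARD('m))"
  have N: "real CARD('n) \<le> N" "real CARD('m) \<le> N" "0 < N"
    by (simp_all add: N_def add_pos_nonneg)
  define \<eta> where "\<eta> = \<epsilon> / N"
  have \<eta>: "0 < \<eta>" "N * \<eta> = \<epsilon>" using \<epsilon> N by (simp_all add: \<eta>_def)
  have s0: "0 < s" using s(2) \<epsilon> by linarith
  obtain A where A: "A \<in> sets M" and
    dev: "\<And>\<omega> r r'. \<omega> \<in> A \<Longrightarrow> \<bar>(\<Sum>k<h. init_entry (W1 \<omega>) (W2 \<omega>) (r, k) * init_entry (W1 \<omega>) (W2 \<omega>) (r', k))
      - of_bool (r = r') * s\<bar> \<le> \<eta>"
    and prob_A: "1 - N\<^sup>2 * (real h * (2 * \<sigma> ^ 4) / \<eta>\<^sup>2) \<le> prob A"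
    using gaussian_init_concentration[OF M init \<sigma> \<eta>(1)] unfolding s(1) N_def by blast
  have "N\<^sup>2 * (real h * (2 * \<sigma> ^ 4) / \<eta>\<^sup>2) = 2 * N ^ 4 / \<epsilon>\<^sup>2 * (real h * \<sigma> ^ 4)"
    using \<epsilon> N by (simp add: \<eta>_def power2_eq_square power4_eq_xxxx)
  then have "1 - \<delta> \<le> prob A" using prob_A \<delta> by (simp add: N_def)
  also have "\<dots> \<le> prob ?good"
  proof (rule finite_measure_mono)
    show "?good \<in> sets M"
    proof (rule measurable_conclusion)
      fix e :: "('n + 'm) \<times> nat" assume "e \<in> UNIV \<times> {..<h}"
      then have "distributed M lborel (\<lambda>\<omega>. init_entry (W1 \<omega>) (W2 \<omega>) e) (\<lambda>x. ennreal (normal_density 0 \<sigma> x))"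
        using init unfolding iid_normal_init_def by blast
      from distributed_measurable[OF this]
      show "(\<lambda>\<omega>. init_entry (W1 \<omega>) (W2 \<omega>) e) \<in> borel_measurable M" by simp
    qed (use h in auto)
    show "A \<subseteq> ?good"
    proof
      fix \<omega> assume \<omega>: "\<omega> \<in> A"
      have "\<bar>trunc_inner h (W1 \<omega> i) (W1 \<omega> i') - of_bool (i = i') * s\<bar> \<le> \<eta>" for i i'
        using dev[OF \<omega>, of "Inl i" "Inl i'"] by (simp add: init_entry_simps trunc_inner_def)
      note dev1 = sqnorm_transp_app_deviation[of h "W1 \<omega>", OF this]
      have "\<bar>trunc_inner h (W2 \<omega> j) (W2 \<omega> j') - of_bool (j = j') * s\<bar> \<le> \<eta>" for j j'
        using dev[OF \<omega>, of "Inr j" "Inr j'"] by (simp add: init_entry_simps trunc_inner_def)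
      note dev2 = sqnorm_transp_app_deviation[of h "W2 \<omega>", OF this]
      have le: "real CARD('n) * \<eta> * (norm x)\<^sup>2 \<le> \<epsilon> * (norm x)\<^sup>2"
        "real CARD('m) * \<eta> * (norm y)\<^sup>2 \<le> \<epsilon> * (norm y)\<^sup>2" for x :: "real ^ 'n" and y :: "real ^ 'm"
        unfolding \<eta>(2)[symmetric] using N \<eta>(1) by (auto intro!: mult_right_mono)
      have "\<bar>(W_prod h (W1 \<omega>) (W2 \<omega>) $ i) $ j\<bar> \<le> \<eta>" for i j
        using dev[OF \<omega>, of "Inl i" "Inr j"] by (simp add: init_entry_simps W_prod_def)
      then have W: "norm (W_prod h (W1 \<omega>) (W2 \<omega>)) \<le> \<epsilon>"
        using norm_le_of_entries[of "W_prod h (W1 \<omega>) (W2 \<omega>)" \<eta>] \<eta>(2) by (simp add: N_def)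
      note conclusion_of_concentration[OF _ _ K s0 _ s(2) order.trans[OF dev1 le(1)] order.trans[OF dev2 le(2)]
          W B \<epsilon>_Wstar]
      then show "\<omega> \<in> ?good"
        using h \<epsilon> \<omega> sets.sets_into_space[OF A] by auto
    qed
  qed
  finally show ?thesis .
qed

theorem theorem3p3:
  fixes l :: "real ^ 'm::finite ^ 'n::finite \<Rightarrow> real"
    and Wstar :: "real ^ 'm ^ 'n"
    and K \<mu> p :: real
  assumes "twice_differentiable l"
    and "K_smooth K l"
    and "strongly_convex \<mu> l"
    and "is_arg_min l (\<lambda>_. True) Wstar"
    and "l Wstar = 0"
    and "1 / 4 < p" and "p < 1 / 2"
  shows "\<exists>P :: real \<times> real \<times> real \<Rightarrow> real. real_polynomial_function P \<and>
    (\<forall>\<delta>\<in>{0<..<1}. \<exists>C>0. \<forall>h::nat. real h \<ge> P (real CARD('m), real CARD('n), 1 / \<delta>) \<longrightarrow>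
      (\<forall>(M :: 'w measure) (W1 :: 'w \<Rightarrow> 'n hmat) (W2 :: 'w \<Rightarrow> 'm hmat).
        prob_space M \<longrightarrow> iid_normal_init M h (real h powr (- p)) W1 W2 \<longrightarrow>
        measure M {\<omega> \<in> space M.
            sigma_min_T h (W1 \<omega>) (W2 \<omega>) / sigma_max_T h (W1 \<omega>) (W2 \<omega>)
              \<ge> alpha1 K \<mu> Wstar h (W1 \<omega>) (W2 \<omega>) / alpha2 K \<mu> Wstar h (W1 \<omega>) (W2 \<omega>) \<and>
            alpha1 K \<mu> Wstar h (W1 \<omega>) (W2 \<omega>) / alpha2 K \<mu> Wstar h (W1 \<omega>) (W2 \<omega>)
              \<ge> 1 - C * real h powr (2 * p - 1)}
          \<ge> 1 - \<delta>))"
proof -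
  have K: "0 < \<mu>" "\<mu> \<le> K"
    using assms(2,3) strongly_convex_le_smooth by (auto simp: strongly_convex_def)
  define N where "N = real (CARD('n) + CARD('m))"
  \<comment> \<open>Independent of \<open>h\<close>, and small against
    \<open>sigma_max Wstar\<close> whenever that is positive.\<close>
  define \<epsilon> where "\<epsilon> = (if Wstar = 0 then 1 else min 1 (sigma_max Wstar / 4))"
  have \<epsilon>: "0 < \<epsilon>" "\<epsilon> \<le> 1" "Wstar \<noteq> 0 \<Longrightarrow> 4 * \<epsilon> \<le> sigma_max Wstar"
    using sigma_max_pos[of Wstar] by (auto simp: \<epsilon>_def)
  define B where "B = sigma_max Wstar + sqrt (K / \<mu>) * (norm Wstar + \<epsilon>)"
  have B: "0 \<le> B" using sigma_max_nonneg[of Wstar] K \<epsilon> by (simp add: B_def)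
  \<comment> \<open>Numerator of the failure probability; at least 1, so that
    \<open>A / \<delta> \<ge> 1\<close> and larger exponents only increase its powers.\<close>
  define A where "A = max 1 (2 * N ^ 4 / \<epsilon>\<^sup>2)"
  \<comment> \<open>\<open>h \<ge> c\<close> yields both \<open>n + m \<le> h\<close> and
    \<open>6 + B \<le> s\<close>.\<close>
  define c where "c = max N ((6 + B) powr (1 / (1 - 2 * p)))"
  \<comment> \<open>The exponent \<open>1 / (4 * p - 1)\<close>, positive as \<open>p > 1/4\<close>,
    is rounded up to make \<open>P\<close> a polynomial.\<close>
  define q where "q = nat \<lceil>1 / (4 * p - 1)\<rceil>"
  \<comment> \<open>The third argument is \<open>1 / \<delta>\<close>; the sizes \<open>n\<close>
    and \<open>m\<close> enter through \<open>N\<close> in \<open>A\<close> and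
    \<open>c\<close>.\<close>
  define P :: "real \<times> real \<times> real \<Rightarrow> real" where "P = (\<lambda>v. (A * snd (snd v)) ^ q + c)"
  have "real_polynomial_function (\<lambda>v :: real \<times> real \<times> real. snd (snd v))"
    by (intro real_polynomial_function.intros(1) bounded_linear_compose[OF bounded_linear_snd bounded_linear_snd])
  then have poly: "real_polynomial_function P"
    unfolding P_def
    by (intro real_polynomial_function.intros(2-4) real_polynomial_function_power)
  define C where "C = 8 * \<epsilon> + 2 * B"
  have C: "0 < C" using \<epsilon> B by (simp add: C_def)
  have main: "1 - \<delta> \<le> measure M {\<omega> \<in> space M.
            sigma_min_T h (W1 \<omega>) (W2 \<omega>) / sigma_max_T h (W1 \<omega>) (W2 \<omega>)
              \<ge> alpha1 K \<mu> Wstar h (W1 \<omega>) (W2 \<omega>) / alpha2 K \<mu> Wstar h (W1 \<omega>) (W2 \<omega>) \<and>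
            alpha1 K \<mu> Wstar h (W1 \<omega>) (W2 \<omega>) / alpha2 K \<mu> Wstar h (W1 \<omega>) (W2 \<omega>)
              \<ge> 1 - C * real h powr (2 * p - 1)}"
    if \<delta>: "0 < \<delta>" "\<delta> < 1" and h: "P (real CARD('m), real CARD('n), 1 / \<delta>) \<le> real h"
      and M: "prob_space M" and init: "iid_normal_init M h (real h powr (- p)) W1 W2"
    for \<delta> h and M :: "'w measure" and W1 :: "'w \<Rightarrow> 'n hmat" and W2 :: "'w \<Rightarrow> 'm hmat"
  proof -
    have A1: "1 \<le> A" by (simp add: A_def)
    then have A\<delta>: "1 \<le> A / \<delta>" using \<delta> by (simp add: le_divide_eq)
    have h1: "(A / \<delta>) ^ q + c \<le> real h" using h by (simp add: P_def)
    moreover have "0 \<le> (A / \<delta>) ^ q" "0 \<le> c"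
      using A\<delta> by (simp_all add: c_def le_max_iff_disj)
    ultimately have hq: "(A / \<delta>) ^ q \<le> real h" and hc: "c \<le> real h" by linarith+
    have hN: "CARD('n) + CARD('m) \<le> h"
      using hc unfolding c_def N_def by (simp only: max.bounded_iff of_nat_le_iff)
    have h0: "0 < real h"
      using hN zero_less_card_finite[where 'a = 'n] by linarith
    define s where "s = real h powr (1 - 2 * p)"
    have "6 + B \<le> s"
      unfolding s_def using hc B assms(7) by (intro powr_ge_of_ge_root) (auto simp: c_def)
    then have sB: "6 * \<epsilon> \<le> s" "B \<le> s" using \<epsilon> B by linarith+
    have hs: "real h * (real h powr (- p))\<^sup>2 = s"
      using h0 powr_add[of "real h" 1 "2 * (- p)"]
      by (simp add: s_def powr_power[of "real h" "- p" 2] mult.commute)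
    \<comment> \<open>The failure probability decays like this negative power of \<open>h\<close>,
      since \<open>4 * p - 1 > 0\<close>.\<close>
    have h4: "real h * (real h powr (- p)) ^ 4 = 1 / real h powr (4 * p - 1)"
      using h0 powr_add[of "real h" 1 "4 * (- p)"] powr_minus_divide[of "real h" "4 * p - 1"]
      by (simp add: powr_power[of "real h" "- p" 4] mult.commute)
    have "A / \<delta> \<le> real h powr (4 * p - 1)"
    proof (rule powr_ge_of_ge_root[OF A\<delta>])
      have "1 / (4 * p - 1) \<le> real q" unfolding q_def by (rule real_nat_ceiling_ge)
      then have "(A / \<delta>) powr (1 / (4 * p - 1)) \<le> (A / \<delta>) powr real q"
        using A\<delta> by (intro powr_mono) auto
      also have "\<dots> = (A / \<delta>) ^ q" using A\<delta> by (intro powr_realpow) linarith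
      finally show "(A / \<delta>) powr (1 / (4 * p - 1)) \<le> real h" using hq by linarith
    qed (use assms(6) in simp)
    then have "A * (1 / real h powr (4 * p - 1)) \<le> \<delta>"
      using h0 \<delta> by (simp add: field_simps)
    moreover have "2 * N ^ 4 / \<epsilon>\<^sup>2 * (1 / real h powr (4 * p - 1)) \<le> A * (1 / real h powr (4 * p - 1))"
      by (intro mult_right_mono) (simp_all add: A_def)
    ultimately have fail: "2 * N ^ 4 / \<epsilon>\<^sup>2 * (real h * (real h powr (- p)) ^ 4) \<le> \<delta>"
      unfolding h4 by linarith
    \<comment> \<open>Here \<open>1 / s\<close> becomes the rate \<open>h\<close> to the power
      \<open>2 * p - 1\<close>.\<close>
    have "(8 * \<epsilon> + 2 * B) / s = C * real h powr (2 * p - 1)"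
      using powr_minus_divide[of "real h" "1 - 2 * p"] by (simp add: C_def s_def)
    then show ?thesis
      using gaussian_init_conclusion[OF M init _ hN K hs sB(1) \<epsilon>(1) fail[unfolded N_def]
          order.refl[of B, unfolded B_def] sB(2)[unfolded B_def] \<epsilon>(3), folded B_def] h0 by simp
  qed
  show ?thesis
    using poly C main by (intro exI[of _ P] conjI ballI exI[of _ C] allI impI) auto
qed

end
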